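(* The expansion $(\mathbb{U},s)_{s\in\mathbb{QU}}$ of the Urysohn space of diameter 1 by constants for all elements of $\mathbb{QU}$ has a decidable continuous theory: for every continuous sentence $\phi(\bar s)$ of the signature $\langle d\rangle$ with parameters $\bar s$ from $\mathbb{QU}$, the value of $\phi(\bar s)$ in $\mathbb{U}$ is a computable real number.
   Context: $\mathbb{U}$ is the Urysohn space of diameter 1 (the unique Polish metric space of diameter $\le1$ that is universal and ultrahomogeneous); $\mathbb{QU}$ is the rational Urysohn space of diameter 1 (countable, ultrahomogeneous, universal for countable metric spaces with rational distances and diameter $\le1$), embedded as a dense subset of $\mathbb{U}$. $\mathbb{QU}$ is given by a fixed presentation on $\omega$ in which the relations $d(x,y)=q$ ($q\in\mathbb{Q}\cap[0,1]$) are decidable; continuous sentences with parameters from $\mathbb{QU}$ are coded by natural numbers in the standard way. Continuous formulas are built from atomic formulas $d(t_1,t_2)$ and $0,1$ using $x/2$, $\dot-$, $\min,\max$, $|x-y|$, $1-x$, $\dot+$, $\sup_x,\inf_x$. A real $r\ge0$ is computable if there is an algorithm which for each $n$ gives $k$ with $(k-1)/n\le r\le(k+1)/n$. *)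

theory Defs
  imports "HOL-Analysis.Analysis" "HOL-Library.Nat_Bijection"
begin

section \<open>Computability\<close>

text \<open>
  The total recursive functions of arity \<open>n\<close>, as functions on lists of length \<open>n\<close>: the closure
  of the initial functions under composition, primitive recursion and minimisation of regular
  functions (Kleene). The rule \<open>cong\<close> makes values on lists of the wrong length irrelevant.
\<close>

inductive recursive :: "nat \<Rightarrow> (nat list \<Rightarrow> nat) \<Rightarrow> bool" where
  zero: "recursive n (\<lambda>xs. 0)"
| suc: "recursive 1 (\<lambda>xs. Suc (xs ! 0))"
| proj: "i < n \<Longrightarrow> recursive n (\<lambda>xs. xs ! i)"
| comp: "recursive m f \<Longrightarrow> length gs = m \<Longrightarrow> (\<And>g. g \<in> set gs \<Longrightarrow> recursive n g)
    \<Longrightarrow> recursive n (\<lambda>xs. f (map (\<lambda>g. g xs) gs))"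
| prim_rec: "recursive n f \<Longrightarrow> recursive (Suc (Suc n)) g
    \<Longrightarrow> recursive (Suc n) (\<lambda>xs. rec_nat (f (tl xs)) (\<lambda>k r. g (k # r # tl xs)) (hd xs))"
| minim: "recursive (Suc n) f \<Longrightarrow> (\<And>xs. length xs = n \<Longrightarrow> \<exists>y. f (y # xs) = 0)
    \<Longrightarrow> recursive n (\<lambda>xs. LEAST y. f (y # xs) = 0)"
| cong: "recursive n f \<Longrightarrow> (\<And>xs. length xs = n \<Longrightarrow> f xs = g xs) \<Longrightarrow> recursive n g"

definition decidable_rel :: "nat \<Rightarrow> (nat list \<Rightarrow> bool) \<Rightarrow> bool" where
  "decidable_rel n P \<longleftrightarrow> recursive n (\<lambda>xs. if P xs then 1 else 0)"

definition approximates :: "nat \<Rightarrow> nat \<Rightarrow> real \<Rightarrow> bool" where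
  "approximates k n r \<longleftrightarrow> (real k - 1) / real n \<le> r \<and> r \<le> (real k + 1) / real n"

definition computable_real :: "real \<Rightarrow> bool" where
  "computable_real r \<longleftrightarrow>
     0 \<le> r \<and> (\<exists>f. recursive 1 f \<and> (\<forall>n\<ge>1. approximates (f [n]) n r))"

section \<open>Urysohn spaces of diameter 1\<close>

definition diam_le_1 :: "'a set \<Rightarrow> ('a \<Rightarrow> 'a \<Rightarrow> real) \<Rightarrow> bool" where
  "diam_le_1 M d \<longleftrightarrow> (\<forall>x\<in>M. \<forall>y\<in>M. d x y \<le> 1)"

definition polish_metric :: "'a set \<Rightarrow> ('a \<Rightarrow> 'a \<Rightarrow> real) \<Rightarrow> bool" where
  "polish_metric M d \<longleftrightarrow>
     Metric_space M d \<and> Metric_space.mcomplete M d \<and> separable_space (Metric_space.mtopology M d)"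

definition isometric_on ::
  "'a set \<Rightarrow> ('a \<Rightarrow> 'a \<Rightarrow> real) \<Rightarrow> ('b \<Rightarrow> 'b \<Rightarrow> real) \<Rightarrow> ('a \<Rightarrow> 'b) \<Rightarrow> bool" where
  "isometric_on M d d' f \<longleftrightarrow> (\<forall>x\<in>M. \<forall>y\<in>M. d' (f x) (f y) = d x y)"

definition ultrahomogeneous :: "'a set \<Rightarrow> ('a \<Rightarrow> 'a \<Rightarrow> real) \<Rightarrow> bool" where
  "ultrahomogeneous M d \<longleftrightarrow>
     (\<forall>A f. finite A \<and> A \<subseteq> M \<and> f ` A \<subseteq> M \<and> isometric_on A d d f \<longrightarrow>
        (\<exists>g. bij_betw g M M \<and> isometric_on M d d g \<and> (\<forall>x\<in>A. g x = f x)))"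

text \<open>
  A separable metric space has at most continuum many points, so up to isometry every Polish
  metric space has a set of reals as its carrier (with an arbitrary metric \<open>\<rho>\<close>); likewise every
  countable metric space has a set of natural numbers as its carrier.
\<close>

definition urysohn_space :: "'a set \<Rightarrow> ('a \<Rightarrow> 'a \<Rightarrow> real) \<Rightarrow> bool" where
  "urysohn_space U d \<longleftrightarrow>
     polish_metric U d \<and> diam_le_1 U d \<and> ultrahomogeneous U d \<and>
     (\<forall>(M::real set) \<rho>. polish_metric M \<rho> \<and> diam_le_1 M \<rho> \<longrightarrow>
        (\<exists>f. f ` M \<subseteq> U \<and> isometric_on M \<rho> d f))"

definition rational_distances :: "'a set \<Rightarrow> ('a \<Rightarrow> 'a \<Rightarrow> real) \<Rightarrow> bool" where
  "rational_distances M d \<longleftrightarrow> (\<forall>x\<in>M. \<forall>y\<in>M. d x y \<in> \<rat>)"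

definition rational_urysohn_space :: "'a set \<Rightarrow> ('a \<Rightarrow> 'a \<Rightarrow> real) \<Rightarrow> bool" where
  "rational_urysohn_space Q d \<longleftrightarrow>
     Metric_space Q d \<and> countable Q \<and> rational_distances Q d \<and> diam_le_1 Q d \<and>
     ultrahomogeneous Q d \<and>
     (\<forall>(M::nat set) \<rho>. Metric_space M \<rho> \<and> rational_distances M \<rho> \<and> diam_le_1 M \<rho> \<longrightarrow>
        (\<exists>f. f ` M \<subseteq> Q \<and> isometric_on M \<rho> d f))"

text \<open>
  A presentation of \<open>Q\<close> on \<open>\<omega>\<close> is a bijection \<open>s\<close> from the natural numbers onto \<open>Q\<close>. The
  relations \<open>d(x,y) = q\<close> are decidable uniformly in \<open>q\<close>, which is given as a fraction \<open>a/b\<close> in the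
  unit interval; the arguments are \<open>[x, y, a, b]\<close>.
\<close>

definition decidable_presentation ::
  "'a set \<Rightarrow> ('a \<Rightarrow> 'a \<Rightarrow> real) \<Rightarrow> (nat \<Rightarrow> 'a) \<Rightarrow> bool" where
  "decidable_presentation Q d s \<longleftrightarrow>
     bij_betw s UNIV Q \<and>
     decidable_rel 4 (\<lambda>xs. 0 < xs ! 3 \<and> xs ! 2 \<le> xs ! 3 \<and>
        d (s (xs ! 0)) (s (xs ! 1)) = real (xs ! 2) / real (xs ! 3))"

section \<open>Continuous logic over the signature of a single metric\<close>

text \<open>The constant symbol \<open>Const i\<close> names the element with number \<open>i\<close> of the presentation.\<close>

datatype cterm = Var nat | Const nat

datatype cform =
    FDist cterm cterm
  | FZero
  | FOne
  | FHalf cform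
  | FMonus cform cform
  | FMin cform cform
  | FMax cform cform
  | FAbsDiff cform cform
  | FNeg cform
  | FPlus cform cform
  | FSup nat cform
  | FInf nat cform

fun tval :: "(nat \<Rightarrow> 'a) \<Rightarrow> (nat \<Rightarrow> 'a) \<Rightarrow> cterm \<Rightarrow> 'a" where
  "tval s e (Var x) = e x"
| "tval s e (Const i) = s i"

fun fval :: "'a set \<Rightarrow> ('a \<Rightarrow> 'a \<Rightarrow> real) \<Rightarrow> (nat \<Rightarrow> 'a) \<Rightarrow> (nat \<Rightarrow> 'a) \<Rightarrow> cform \<Rightarrow> real" where
  "fval M d s e (FDist t u) = d (tval s e t) (tval s e u)"
| "fval M d s e FZero = 0"
| "fval M d s e FOne = 1"
| "fval M d s e (FHalf \<phi>) = fval M d s e \<phi> / 2"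
| "fval M d s e (FMonus \<phi> \<psi>) = max (fval M d s e \<phi> - fval M d s e \<psi>) 0"
| "fval M d s e (FMin \<phi> \<psi>) = min (fval M d s e \<phi>) (fval M d s e \<psi>)"
| "fval M d s e (FMax \<phi> \<psi>) = max (fval M d s e \<phi>) (fval M d s e \<psi>)"
| "fval M d s e (FAbsDiff \<phi> \<psi>) = \<bar>fval M d s e \<phi> - fval M d s e \<psi>\<bar>"
| "fval M d s e (FNeg \<phi>) = 1 - fval M d s e \<phi>"
| "fval M d s e (FPlus \<phi> \<psi>) = min (fval M d s e \<phi> + fval M d s e \<psi>) 1"
| "fval M d s e (FSup x \<phi>) = (SUP a\<in>M. fval M d s (e(x := a)) \<phi>)"
| "fval M d s e (FInf x \<phi>) = (INF a\<in>M. fval M d s (e(x := a)) \<phi>)"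

fun tvars :: "cterm \<Rightarrow> nat set" where
  "tvars (Var x) = {x}"
| "tvars (Const i) = {}"

fun fvars :: "cform \<Rightarrow> nat set" where
  "fvars (FDist t u) = tvars t \<union> tvars u"
| "fvars FZero = {}"
| "fvars FOne = {}"
| "fvars (FHalf \<phi>) = fvars \<phi>"
| "fvars (FMonus \<phi> \<psi>) = fvars \<phi> \<union> fvars \<psi>"
| "fvars (FMin \<phi> \<psi>) = fvars \<phi> \<union> fvars \<psi>"
| "fvars (FMax \<phi> \<psi>) = fvars \<phi> \<union> fvars \<psi>"
| "fvars (FAbsDiff \<phi> \<psi>) = fvars \<phi> \<union> fvars \<psi>"
| "fvars (FNeg \<phi>) = fvars \<phi>"
| "fvars (FPlus \<phi> \<psi>) = fvars \<phi> \<union> fvars \<psi>"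
| "fvars (FSup x \<phi>) = fvars \<phi> - {x}"
| "fvars (FInf x \<phi>) = fvars \<phi> - {x}"

definition sentence :: "cform \<Rightarrow> bool" where
  "sentence \<phi> \<longleftrightarrow> fvars \<phi> = {}"

text \<open>The assignment plays no role for sentences, by \<open>sval_eq_fval\<close> below.\<close>

definition sval :: "'a set \<Rightarrow> ('a \<Rightarrow> 'a \<Rightarrow> real) \<Rightarrow> (nat \<Rightarrow> 'a) \<Rightarrow> cform \<Rightarrow> real" where
  "sval M d s \<phi> = fval M d s (\<lambda>x. undefined) \<phi>"

lemma tval_cong: "(\<And>x. x \<in> tvars t \<Longrightarrow> e x = e' x) \<Longrightarrow> tval s e t = tval s e' t"
  by (cases t) auto

lemma fval_cong: "(\<And>x. x \<in> fvars \<phi> \<Longrightarrow> e x = e' x) \<Longrightarrow> fval M d s e \<phi> = fval M d s e' \<phi>"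
proof (induction \<phi> arbitrary: e e')
  case (FDist t u)
  have "tval s e t = tval s e' t" "tval s e u = tval s e' u"
    by (rule tval_cong; use FDist in simp)+
  then show ?case by simp
next
  case (FSup x \<phi>)
  have "fval M d s (e(x := a)) \<phi> = fval M d s (e'(x := a)) \<phi>" for a
    by (rule FSup.IH) (use FSup.prems in auto)
  then show ?case by simp
next
  case (FInf x \<phi>)
  have "fval M d s (e(x := a)) \<phi> = fval M d s (e'(x := a)) \<phi>" for a
    by (rule FInf.IH) (use FInf.prems in auto)
  then show ?case by simp
next
  case (FHalf \<phi>)
  have "fval M d s e \<phi> = fval M d s e' \<phi>"
    by (rule FHalf.IH) (use FHalf.prems in simp)
  then show ?case by (simp only: fval.simps)
next
  case (FMonus \<phi> \<psi>)
  have "fval M d s e \<phi> = fval M d s e' \<phi>"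
    by (rule FMonus.IH(1)) (use FMonus.prems in simp)
  moreover have "fval M d s e \<psi> = fval M d s e' \<psi>"
    by (rule FMonus.IH(2)) (use FMonus.prems in simp)
  ultimately show ?case by (simp only: fval.simps)
next
  case (FMin \<phi> \<psi>)
  have "fval M d s e \<phi> = fval M d s e' \<phi>"
    by (rule FMin.IH(1)) (use FMin.prems in simp)
  moreover have "fval M d s e \<psi> = fval M d s e' \<psi>"
    by (rule FMin.IH(2)) (use FMin.prems in simp)
  ultimately show ?case by (simp only: fval.simps)
next
  case (FMax \<phi> \<psi>)
  have "fval M d s e \<phi> = fval M d s e' \<phi>"
    by (rule FMax.IH(1)) (use FMax.prems in simp)
  moreover have "fval M d s e \<psi> = fval M d s e' \<psi>"
    by (rule FMax.IH(2)) (use FMax.prems in simp)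
  ultimately show ?case by (simp only: fval.simps)
next
  case (FAbsDiff \<phi> \<psi>)
  have "fval M d s e \<phi> = fval M d s e' \<phi>"
    by (rule FAbsDiff.IH(1)) (use FAbsDiff.prems in simp)
  moreover have "fval M d s e \<psi> = fval M d s e' \<psi>"
    by (rule FAbsDiff.IH(2)) (use FAbsDiff.prems in simp)
  ultimately show ?case by (simp only: fval.simps)
next
  case (FNeg \<phi>)
  have "fval M d s e \<phi> = fval M d s e' \<phi>"
    by (rule FNeg.IH) (use FNeg.prems in simp)
  then show ?case by (simp only: fval.simps)
next
  case (FPlus \<phi> \<psi>)
  have "fval M d s e \<phi> = fval M d s e' \<phi>"
    by (rule FPlus.IH(1)) (use FPlus.prems in simp)
  moreover have "fval M d s e \<psi> = fval M d s e' \<psi>"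
    by (rule FPlus.IH(2)) (use FPlus.prems in simp)
  ultimately show ?case by (simp only: fval.simps)
qed simp_all

lemma sval_eq_fval: "sentence \<phi> \<Longrightarrow> sval M d s \<phi> = fval M d s e \<phi>"
  unfolding sentence_def sval_def by (rule fval_cong) simp

fun tcode :: "cterm \<Rightarrow> nat" where
  "tcode (Var x) = prod_encode (0, x)"
| "tcode (Const i) = prod_encode (1, i)"

fun fcode :: "cform \<Rightarrow> nat" where
  "fcode (FDist t u) = prod_encode (0, prod_encode (tcode t, tcode u))"
| "fcode FZero = prod_encode (1, 0)"
| "fcode FOne = prod_encode (2, 0)"
| "fcode (FHalf \<phi>) = prod_encode (3, fcode \<phi>)"
| "fcode (FMonus \<phi> \<psi>) = prod_encode (4, prod_encode (fcode \<phi>, fcode \<psi>))"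
| "fcode (FMin \<phi> \<psi>) = prod_encode (5, prod_encode (fcode \<phi>, fcode \<psi>))"
| "fcode (FMax \<phi> \<psi>) = prod_encode (6, prod_encode (fcode \<phi>, fcode \<psi>))"
| "fcode (FAbsDiff \<phi> \<psi>) = prod_encode (7, prod_encode (fcode \<phi>, fcode \<psi>))"
| "fcode (FNeg \<phi>) = prod_encode (8, fcode \<phi>)"
| "fcode (FPlus \<phi> \<psi>) = prod_encode (9, prod_encode (fcode \<phi>, fcode \<psi>))"
| "fcode (FSup x \<phi>) = prod_encode (10, prod_encode (x, fcode \<phi>))"
| "fcode (FInf x \<phi>) = prod_encode (11, prod_encode (x, fcode \<phi>))"

lemma tcode_inject: "tcode t = tcode u \<longleftrightarrow> t = u"
  by (cases t; cases u) auto

lemma fcode_inject: "fcode \<phi> = fcode \<psi> \<longleftrightarrow> \<phi> = \<psi>"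
proof (induction \<phi> arbitrary: \<psi>)
  case (FDist t u)
  then show ?case by (cases \<psi>) (auto simp: tcode_inject)
qed (case_tac \<psi>; simp)+

text \<open>
  The continuous theory of \<open>(M, s)\<close> is decidable if the values of its sentences are computable
  reals uniformly in the code of the sentence.
\<close>

definition decidable_continuous_theory ::
  "'a set \<Rightarrow> ('a \<Rightarrow> 'a \<Rightarrow> real) \<Rightarrow> (nat \<Rightarrow> 'a) \<Rightarrow> bool" where
  "decidable_continuous_theory M d s \<longleftrightarrow>
     (\<exists>f. recursive 2 f \<and>
        (\<forall>\<phi>. sentence \<phi> \<longrightarrow> (\<forall>n\<ge>1. approximates (f [fcode \<phi>, n]) n (sval M d s \<phi>))))"

end

theory Submission
  imports Defs
begin

text \<open>
  By ultrahomogeneity the value of a formula at a finite tuple depends only on the distances within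
  the tuple, and it is Lipschitz in the tuple with a constant read off the formula. Over finitely many
  points of \<open>QU\<close> whose distances are multiples of \<open>1/N\<close>, every one-point extension type is within
  \<open>1/N\<close> of a type with distances in \<open>{0, 1/N, \<dots>, 1}\<close> (round up), and these finitely many types
  are realised in \<open>QU\<close>, hence in an initial segment of the presentation which a search finds. So
  every quantifier may be restricted to a computable finite initial segment, depending on its nesting
  depth, at the cost of a controlled error; the sentence is then evaluated by course-of-values
  recursion on codes.
\<close>

section \<open>Closure properties of the recursive functions\<close>

text \<open>\<open>U\<close> is bounded but not totally bounded, so no finite set of points comes
  close to every point and a quantifier cannot be cut down to a metric net. Only the type of a point
  over finitely many others can be approximated finitely. The bridge from close types to close
  values is \<open>near_conjugate\<close>: if two points have nearly the same distances to a finite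
  set, an automorphism fixing that set carries one near the other, and the Lipschitz bound applies.
  Since types are taken over the points already chosen, each net depends on the one outside it. A
  quantifier also changes the assignment of its body, so values are tabulated for pairs of code and
  assignment; the code \<open>c\<close> of the sentence bounds in advance the variables and points
  that occur. The error, in units of 1/S, is at most T = 2 (c + 1)^2 whatever \<open>S\<close> is;
  hence the scale S = 2 T n in \<open>value_approx\<close>.\<close>

named_theorems rec_intros

lemma recursive_comp1:
  assumes "recursive 1 (\<lambda>xs. f (xs ! 0))" "recursive n a"
  shows "recursive n (\<lambda>xs. f (a xs))"
  using recursive.comp[of 1 _ "[a]" n, OF assms(1)] assms(2) by simp

lemma recursive_comp2:
  assumes "recursive 2 (\<lambda>xs. f (xs ! 0) (xs ! 1))" "recursive n a" "recursive n b"
  shows "recursive n (\<lambda>xs. f (a xs) (b xs))"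
  using recursive.comp[of 2 _ "[a, b]" n, OF assms(1)] assms(2-) by auto

lemma recursive_comp3:
  assumes "recursive 3 (\<lambda>xs. f (xs ! 0) (xs ! 1) (xs ! 2))"
    "recursive n a" "recursive n b" "recursive n c"
  shows "recursive n (\<lambda>xs. f (a xs) (b xs) (c xs))"
  using recursive.comp[of 3 _ "[a, b, c]" n, OF assms(1)] assms(2-) by auto

lemma recursive_comp4:
  assumes "recursive 4 (\<lambda>xs. f (xs ! 0) (xs ! 1) (xs ! 2) (xs ! 3))"
    "recursive n a" "recursive n b" "recursive n c" "recursive n d"
  shows "recursive n (\<lambda>xs. f (a xs) (b xs) (c xs) (d xs))"
  using recursive.comp[of 4 _ "[a, b, c, d]" n, OF assms(1)] assms(2-) by auto

lemma recursive_comp5: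
  assumes "recursive 5 (\<lambda>xs. f (xs ! 0) (xs ! 1) (xs ! 2) (xs ! 3) (xs ! 4))"
    "recursive n a" "recursive n b" "recursive n c" "recursive n d" "recursive n e"
  shows "recursive n (\<lambda>xs. f (a xs) (b xs) (c xs) (d xs) (e xs))"
  using recursive.comp[of 5 _ "[a, b, c, d, e]" n, OF assms(1)] assms(2-) by auto

text \<open>
  A binder extends the list of arguments at its front, so below \<open>k\<close> binders the \<open>i\<close>-th outer
  argument appears as \<open>tl (\<dots> (tl ys)) ! i\<close>.
\<close>

lemma recursive_nth [rec_intros]: "i < n \<Longrightarrow> recursive n (\<lambda>xs. xs ! i)"
  by (rule recursive.proj)

lemma recursive_nth_tl [rec_intros]: "Suc i < n \<Longrightarrow> recursive n (\<lambda>xs. tl xs ! i)"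
  by (rule recursive.cong[OF recursive.proj[of "Suc i"]]) (auto simp: nth_tl)

lemma recursive_nth_tl_tl [rec_intros]:
  "Suc (Suc i) < n \<Longrightarrow> recursive n (\<lambda>xs. tl (tl xs) ! i)"
  by (rule recursive.cong[OF recursive.proj[of "Suc (Suc i)"]]) (auto simp: nth_tl)

lemma recursive_nth_tl_tl_tl [rec_intros]:
  "Suc (Suc (Suc i)) < n \<Longrightarrow> recursive n (\<lambda>xs. tl (tl (tl xs)) ! i)"
  by (rule recursive.cong[OF recursive.proj[of "Suc (Suc (Suc i))"]]) (auto simp: nth_tl)

lemma recursive_nth_tl_tl_tl_tl [rec_intros]:
  "Suc (Suc (Suc (Suc i))) < n \<Longrightarrow> recursive n (\<lambda>xs. tl (tl (tl (tl xs))) ! i)"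
  by (rule recursive.cong[OF recursive.proj[of "Suc (Suc (Suc (Suc i)))"]]) (auto simp: nth_tl)

lemma recursive_Suc [rec_intros]: "recursive n a \<Longrightarrow> recursive n (\<lambda>xs. Suc (a xs))"
  by (rule recursive_comp1[of Suc]) (use recursive.suc in simp_all)

lemma recursive_const [rec_intros]: "recursive n (\<lambda>xs. k)"
  by (induction k) (auto intro: recursive.zero recursive_Suc)

text \<open>\<open>prim_rec\<close> recurses on the head of the list and keeps only the tail.
  Composing with \<open>h\<close> and all projections builds the list \<open>h xs # xs\<close>, so
  the recursion may run to any \<open>h xs\<close> with the whole of \<open>xs\<close> as
  parameters.\<close>

lemma recursive_rec_nat:
  assumes f: "recursive n f"
    and g: "recursive (Suc (Suc n)) (\<lambda>ys. g (ys ! 0) (ys ! 1) (tl (tl ys)))"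
    and h: "recursive n h"
  shows "recursive n (\<lambda>xs. rec_nat (f xs) (\<lambda>k r. g k r xs) (h xs))"
proof -
  let ?gs = "h # map (\<lambda>i xs. xs ! i) [0..<n]"
  have "recursive n (\<lambda>xs. (\<lambda>xs. rec_nat (f (tl xs)) (\<lambda>k r. g k r (tl xs)) (hd xs))
      (map (\<lambda>g. g xs) ?gs))"
    by (rule recursive.comp[where m = "Suc n"])
      (use recursive.prim_rec[OF f g] h in \<open>auto intro: recursive.proj\<close>)
  then show ?thesis
  proof (rule recursive.cong)
    fix xs :: "nat list"
    assume "length xs = n"
    then have "map (\<lambda>i. xs ! i) [0..<n] = xs" using map_nth[of xs] by simp
    then show "rec_nat (f (tl (map (\<lambda>g. g xs) ?gs))) (\<lambda>k r. g k r (tl (map (\<lambda>g. g xs) ?gs)))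
       (hd (map (\<lambda>g. g xs) ?gs)) = rec_nat (f xs) (\<lambda>k r. g k r xs) (h xs)"
      by (simp add: comp_def)
  qed
qed

text \<open>In the step of a primitive recursion the accumulator sits between the counter and the
  parameters; this removes it for functions that do not depend on it.\<close>

lemma recursive_skip_second:
  assumes f: "recursive (Suc n) f"
  shows "recursive (Suc (Suc n)) (\<lambda>ys. f (ys ! 0 # tl (tl ys)))"
proof -
  let ?gs = "(\<lambda>ys. ys ! 0) # map (\<lambda>i ys. ys ! Suc (Suc i)) [0..<n]"
  have "recursive (Suc (Suc n)) (\<lambda>xs. f (map (\<lambda>g. g xs) ?gs))"
    by (rule recursive.comp[OF f]) (auto intro: recursive.proj)
  then show ?thesis
  proof (rule recursive.cong)
    fix xs :: "nat list"
    assume l: "length xs = Suc (Suc n)"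
    have "map (\<lambda>i. xs ! Suc (Suc i)) [0..<n] = tl (tl xs)"
      using l by (intro nth_equalityI) (auto simp: nth_tl)
    then show "f (map (\<lambda>g. g xs) ?gs) = f (xs ! 0 # tl (tl xs))" by (simp add: comp_def)
  qed
qed

lemma recursive_add [rec_intros]:
  assumes "recursive n a" "recursive n b"
  shows "recursive n (\<lambda>xs. a xs + b xs)"
proof -
  have eq: "rec_nat x (\<lambda>k r. Suc r) y = x + y" for x y by (induction y) auto
  have "recursive n (\<lambda>xs. rec_nat (a xs) (\<lambda>k r. Suc r) (b xs))"
    by (intro recursive_rec_nat rec_intros assms) auto
  then show ?thesis unfolding eq .
qed

lemma recursive_mult [rec_intros]:
  assumes "recursive n a" "recursive n b"
  shows "recursive n (\<lambda>xs. a xs * b xs)"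
proof -
  have eq: "rec_nat 0 (\<lambda>k r. r + x) y = x * y" for x y :: nat by (induction y) auto
  \<comment> \<open>At arity 2 the factor is a projection, for which \<open>rec_intros\<close> has
    rules below binders; \<open>a\<close> itself would appear there as
    \<open>a (tl (tl ys))\<close>.\<close>
  have "recursive 2 (\<lambda>xs. rec_nat 0 (\<lambda>k r. r + xs ! 0) (xs ! 1))"
    by (intro recursive_rec_nat rec_intros) auto
  then show ?thesis unfolding eq using assms by (rule recursive_comp2)
qed

lemma recursive_power [rec_intros]:
  assumes "recursive n a" "recursive n b"
  shows "recursive n (\<lambda>xs. a xs ^ b xs)"
proof -
  have eq: "rec_nat 1 (\<lambda>k r. r * x) y = x ^ y" for x y :: nat by (induction y) auto
  have "recursive 2 (\<lambda>xs. rec_nat 1 (\<lambda>k r. r * xs ! 0) (xs ! 1))"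
    by (intro recursive_rec_nat rec_intros) auto
  then show ?thesis unfolding eq using assms by (rule recursive_comp2)
qed

lemma recursive_diff [rec_intros]:
  assumes "recursive n a" "recursive n b"
  shows "recursive n (\<lambda>xs. a xs - b xs)"
proof -
  have pred: "rec_nat 0 (\<lambda>k r. k) y = y - 1" for y :: nat by (cases y) auto
  have "recursive 1 (\<lambda>xs. rec_nat 0 (\<lambda>k r. k) (xs ! 0))"
    by (intro recursive_rec_nat rec_intros) auto
  then have p: "recursive m f \<Longrightarrow> recursive m (\<lambda>xs. f xs - 1)" for m f
    unfolding pred by (rule recursive_comp1)
  have eq: "rec_nat x (\<lambda>k r. r - 1) y = x - y" for x y :: nat by (induction y) auto
  have "recursive 2 (\<lambda>xs. rec_nat (xs ! 0) (\<lambda>k r. r - 1) (xs ! 1))"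
    by (intro recursive_rec_nat p rec_intros) auto
  then show ?thesis unfolding eq using assms by (rule recursive_comp2)
qed

text \<open>Definition by cases is a recursion over the characteristic value, which runs for at most
  one step.\<close>

lemma recursive_if [rec_intros]:
  assumes "decidable_rel n P" "recursive n a" "recursive n b"
  shows "recursive n (\<lambda>xs. if P xs then a xs else b xs)"
proof -
  have eq: "rec_nat y (\<lambda>k r. x) (if P then 1 else 0) = (if P then x else y)" for P and x y :: nat
    by simp
  have "recursive 3 (\<lambda>xs. rec_nat (xs ! 2) (\<lambda>k r. xs ! 1) (xs ! 0))"
    by (intro recursive_rec_nat rec_intros) auto
  then have "recursive n (\<lambda>xs. rec_nat (b xs) (\<lambda>k r. a xs) (if P xs then 1 else 0))"
    using assms[unfolded decidable_rel_def] by (rule recursive_comp3)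
  then show ?thesis unfolding eq .
qed

lemma decidable_not [rec_intros]: "decidable_rel n P \<Longrightarrow> decidable_rel n (\<lambda>xs. \<not> P xs)"
  unfolding decidable_rel_def
  by (erule recursive.cong[OF recursive_diff[OF recursive_const[of _ 1]]]) simp

lemma decidable_conj [rec_intros]:
  "decidable_rel n P \<Longrightarrow> decidable_rel n Q \<Longrightarrow> decidable_rel n (\<lambda>xs. P xs \<and> Q xs)"
  unfolding decidable_rel_def by (erule (1) recursive.cong[OF recursive_mult]) simp

lemma decidable_disj [rec_intros]:
  "decidable_rel n P \<Longrightarrow> decidable_rel n Q \<Longrightarrow> decidable_rel n (\<lambda>xs. P xs \<or> Q xs)"
  using decidable_not[OF decidable_conj[OF decidable_not decidable_not]] by simp

lemma decidable_imp [rec_intros]: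
  "decidable_rel n P \<Longrightarrow> decidable_rel n Q \<Longrightarrow> decidable_rel n (\<lambda>xs. P xs \<longrightarrow> Q xs)"
  using decidable_not[OF decidable_conj[OF _ decidable_not]] by simp

text \<open>With truncated subtraction, \<open>1 - (a - b)\<close> is the characteristic
  function.\<close>

lemma decidable_le [rec_intros]:
  "recursive n a \<Longrightarrow> recursive n b \<Longrightarrow> decidable_rel n (\<lambda>xs. a xs \<le> b xs)"
  unfolding decidable_rel_def
  by (erule (1) recursive.cong[OF recursive_diff[OF recursive_const[of _ 1] recursive_diff]]) auto

lemma decidable_less [rec_intros]:
  "recursive n a \<Longrightarrow> recursive n b \<Longrightarrow> decidable_rel n (\<lambda>xs. a xs < b xs)"
  using decidable_not[OF decidable_le] by (simp add: not_le)

lemma decidable_eq [rec_intros]: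
  "recursive n a \<Longrightarrow> recursive n b \<Longrightarrow> decidable_rel n (\<lambda>xs. a xs = b xs)"
  using decidable_conj[OF decidable_le decidable_le, of n a b b a] by (simp add: eq_iff)

lemma recursive_min [rec_intros]:
  "recursive n a \<Longrightarrow> recursive n b \<Longrightarrow> recursive n (\<lambda>xs. min (a xs) (b xs))"
  unfolding min_def by (intro rec_intros)

lemma recursive_max [rec_intros]:
  "recursive n a \<Longrightarrow> recursive n b \<Longrightarrow> recursive n (\<lambda>xs. max (a xs) (b xs))"
  unfolding max_def by (intro rec_intros)

text \<open>A bounded universal quantifier is a product of characteristic values.\<close>

lemma decidable_all_less [rec_intros]:
  assumes b: "recursive n b" and P: "decidable_rel (Suc n) (\<lambda>ys. P (ys ! 0) (tl ys))"
  shows "decidable_rel n (\<lambda>xs. \<forall>i<b xs. P i xs)"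
proof -
  have eq: "rec_nat 1 (\<lambda>k r. r * (if Q k then 1 else 0)) m =
      (if \<forall>i<m. Q i then 1 else (0::nat))"
    for Q :: "nat \<Rightarrow> bool" and m :: nat
    by (induction m) (auto simp: less_Suc_eq)
  have "recursive n (\<lambda>xs. rec_nat 1 (\<lambda>k r. r * (if P k xs then 1 else 0)) (b xs))"
    using recursive_skip_second[OF P[unfolded decidable_rel_def]]
    by (intro recursive_rec_nat recursive_mult recursive_nth recursive_const b) auto
  then show ?thesis unfolding eq decidable_rel_def .
qed

lemma decidable_ex_less [rec_intros]:
  assumes "recursive n b" "decidable_rel (Suc n) (\<lambda>ys. P (ys ! 0) (tl ys))"
  shows "decidable_rel n (\<lambda>xs. \<exists>i<b xs. P i xs)"
  using decidable_not[OF decidable_all_less[OF assms(1) decidable_not[OF assms(2)]]] by simp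

text \<open>The second premise is the regularity that minimisation demands: every search below has
  to be shown to succeed on all arguments.\<close>

lemma recursive_Least [rec_intros]:
  assumes "decidable_rel (Suc n) (\<lambda>ys. P (ys ! 0) (tl ys))"
    and "\<And>xs. length xs = n \<Longrightarrow> \<exists>y. P y xs"
  shows "recursive n (\<lambda>xs. LEAST y. P y xs)"
proof -
  have "recursive (Suc n) (\<lambda>ys. if P (ys ! 0) (tl ys) then 0 else 1)"
    by (intro rec_intros assms(1))
  from recursive.minim[OF this] have
    "recursive n (\<lambda>xs. LEAST y. (if P y xs then 0 else (1::nat)) = 0)"
    using assms(2) by (simp split: if_splits)
  moreover have "((if Q then 0 else (1::nat)) = 0) = Q" for Q by simp
  ultimately show ?thesis by simp
qed

lemma recursive_div [rec_intros]:
  assumes "recursive n a" "recursive n b"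
  shows "recursive n (\<lambda>xs. a xs div b xs)"
proof -
  \<comment> \<open>The disjunct \<open>y = 0\<close> lets the search end for a zero divisor, at 0,
    which is the value of \<open>x div 0\<close>.\<close>
  have ex: "y = 0 \<or> x < Suc (x div y) * y" for x y :: nat
    using dividend_less_div_times[of y x] by auto
  have eq: "(LEAST q. y = 0 \<or> x < Suc q * y) = x div y" for x y :: nat
  proof (rule Least_equality, rule ex)
    fix q assume "y = 0 \<or> x < Suc q * y"
    then show "x div y \<le> q"
      by (metis div_by_0 le0 less_Suc_eq_le less_mult_imp_div_less)
  qed
  have "recursive 2 (\<lambda>xs. LEAST q. xs ! 1 = 0 \<or> xs ! 0 < Suc q * xs ! 1)"
    by (intro rec_intros) (use ex in auto)
  then show ?thesis unfolding eq using assms by (rule recursive_comp2)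
qed

lemma recursive_mod [rec_intros]:
  "recursive n a \<Longrightarrow> recursive n b \<Longrightarrow> recursive n (\<lambda>xs. a xs mod b xs)"
  unfolding minus_div_mult_eq_mod[symmetric] by (intro rec_intros)

lemma recursive_prod_encode [rec_intros]:
  "recursive n a \<Longrightarrow> recursive n b \<Longrightarrow> recursive n (\<lambda>xs. prod_encode (a xs, b xs))"
  unfolding prod_encode_def triangle_def by simp (intro rec_intros)

definition pfst :: "nat \<Rightarrow> nat" where
  "pfst z = fst (prod_decode z)"

definition psnd :: "nat \<Rightarrow> nat" where
  "psnd z = snd (prod_decode z)"

lemma pfst_prod_encode [simp]: "pfst (prod_encode (a, b)) = a"
  by (simp add: pfst_def)

lemma psnd_prod_encode [simp]: "psnd (prod_encode (a, b)) = b"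
  by (simp add: psnd_def)

lemma prod_encode_pfst_psnd: "prod_encode (pfst z, psnd z) = z"
  by (simp add: pfst_def psnd_def)

lemma pfst_le: "pfst z \<le> z"
  by (metis le_prod_encode_1 prod_encode_pfst_psnd)

lemma psnd_le: "psnd z \<le> z"
  by (metis le_prod_encode_2 prod_encode_pfst_psnd)

lemma recursive_pfst [rec_intros]:
  assumes "recursive n a"
  shows "recursive n (\<lambda>xs. pfst (a xs))"
proof -
  \<comment> \<open>The inequality \<open>psnd z \<le> z\<close> allows a bounded inner quantifier,
    so the condition minimised over \<open>i\<close> is decidable.\<close>
  have ex: "\<exists>j<Suc z. prod_encode (pfst z, j) = z" for z
    using psnd_le[of z] prod_encode_pfst_psnd[of z] by (auto simp: less_Suc_eq_le)
  then have ex': "\<exists>i. \<exists>j<Suc z. prod_encode (i, j) = z" for z by blast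
  have eq: "(LEAST i. \<exists>j<Suc z. prod_encode (i, j) = z) = pfst z" for z
    by (rule Least_equality, rule ex) auto
  have "recursive 1 (\<lambda>xs. LEAST i. \<exists>j<Suc (xs ! 0). prod_encode (i, j) = xs ! 0)"
    by (intro rec_intros ex') auto
  then show ?thesis unfolding eq using assms by (rule recursive_comp1)
qed

lemma recursive_psnd [rec_intros]:
  assumes "recursive n a"
  shows "recursive n (\<lambda>xs. psnd (a xs))"
proof -
  have eq: "(LEAST j. prod_encode (pfst z, j) = z) = psnd z" for z
    by (rule Least_equality) (auto simp: prod_encode_pfst_psnd dest: arg_cong[of _ _ psnd])
  have "recursive 1 (\<lambda>xs. LEAST j. prod_encode (pfst (xs ! 0), j) = xs ! 0)"
    by (intro rec_intros) (use prod_encode_pfst_psnd in auto)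
  then show ?thesis unfolding eq using assms by (rule recursive_comp1)
qed

section \<open>Coding finite sequences by digits\<close>

text \<open>Digits make the sequences of length \<open>m\<close> with entries below \<open>b\<close>
  exactly the numbers below \<open>b ^ m\<close>, so quantifying over all of them is bounded. Types,
  assignments and the table of values are all coded in this way.\<close>

definition dig :: "nat \<Rightarrow> nat \<Rightarrow> nat \<Rightarrow> nat" where
  "dig b g i = g div b ^ i mod b"

definition upd :: "nat \<Rightarrow> nat \<Rightarrow> nat \<Rightarrow> nat \<Rightarrow> nat" where
  "upd b e x y = e mod b ^ x + y * b ^ x + (e div b ^ Suc x) * b ^ Suc x"

lemma recursive_dig [rec_intros]:
  "recursive n a \<Longrightarrow> recursive n b \<Longrightarrow> recursive n c \<Longrightarrow>
    recursive n (\<lambda>xs. dig (a xs) (b xs) (c xs))"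
  unfolding dig_def by (intro rec_intros)

lemma recursive_upd [rec_intros]:
  "recursive n a \<Longrightarrow> recursive n b \<Longrightarrow> recursive n c \<Longrightarrow> recursive n d \<Longrightarrow>
    recursive n (\<lambda>xs. upd (a xs) (b xs) (c xs) (d xs))"
  unfolding upd_def by (intro rec_intros)

lemma dig_less: "0 < b \<Longrightarrow> dig b g i < b"
  by (simp add: dig_def)

lemma dig_0 [simp]: "dig b 0 i = 0"
  by (simp add: dig_def)

lemma dig_split:
  assumes lo: "lo < b ^ x" and y: "y < b"
  shows "dig b (lo + y * b ^ x + hi * b ^ Suc x) z =
    (if z < x then dig b lo z else if z = x then y else dig b hi (z - Suc x))"
proof -
  have b: "0 < b" using y by simp
  have top: "(lo + y * b ^ x + hi * b ^ Suc x) div b ^ x = y + hi * b"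
  proof -
    have "lo + y * b ^ x + hi * b ^ Suc x = lo + (y + hi * b) * b ^ x"
      by (simp add: algebra_simps)
    then show ?thesis using lo b by (simp only: div_mult_self1) simp
  qed
  consider "z < x" | "z = x" | "x < z" by linarith
  then show ?thesis
  proof cases
    case 1
    then obtain k where x: "x = Suc (z + k)" using less_imp_Suc_add by blast
    \<comment> \<open>Everything from position \<open>x\<close> on is a multiple of
      \<open>b ^ Suc z\<close> and disappears modulo \<open>b\<close> after division by
      \<open>b ^ z\<close>.\<close>
    have "lo + y * b ^ x + hi * b ^ Suc x = lo + (((y + hi * b) * b ^ k) * b) * b ^ z"
      by (simp add: x power_add algebra_simps)
    then have "(lo + y * b ^ x + hi * b ^ Suc x) div b ^ z =
        ((y + hi * b) * b ^ k) * b + lo div b ^ z"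
      using b by (simp only: div_mult_self1) simp
    then show ?thesis using 1 by (simp only: dig_def) simp
  next
    case 2
    then show ?thesis using y by (simp only: dig_def top) simp
  next
    case 3
    then obtain k where z: "z = Suc (x + k)" using less_imp_Suc_add by blast
    have "b ^ z = b ^ x * (b * b ^ k)" by (simp add: z power_add algebra_simps)
    then have "(lo + y * b ^ x + hi * b ^ Suc x) div b ^ z = hi div b ^ k"
      by (simp only: div_mult2_eq top) (use y in simp)
    then show ?thesis using 3 by (simp only: dig_def) (simp add: z)
  qed
qed

lemma upd_dig_same: "upd b e x (dig b e x) = e"
proof -
  have "e div b ^ x = dig b e x + (e div b ^ Suc x) * b"
    by (simp add: dig_def div_mult2_eq mult.commute[of b] del: power_Suc add: power_Suc2)
  then have "e = e mod b ^ x + (dig b e x + (e div b ^ Suc x) * b) * b ^ x"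
    by (metis mod_div_mult_eq)
  then show ?thesis by (simp add: upd_def algebra_simps)
qed

lemma dig_upd:
  assumes "y < b"
  shows "dig b (upd b e x y) z = (if z = x then y else dig b e z)"
proof -
  have b: "0 < b" using assms by simp
  have eq: "dig b (upd b e x v) z = (if z < x then dig b (e mod b ^ x) z
      else if z = x then v else dig b (e div b ^ Suc x) (z - Suc x))" if "v < b" for v
    unfolding upd_def by (rule dig_split) (use that b in auto)
  \<comment> \<open>The second instance is the update by the digit already present, which returns
    \<open>e\<close>; comparison identifies the digits away from \<open>x\<close>.\<close>
  show ?thesis
    using eq[OF assms] eq[OF dig_less[OF b, of e x]] by (simp add: upd_dig_same split: if_splits)
qed

lemma upd_less:
  assumes e: "e < b ^ n" and "x < n" and y: "y < b"
  shows "upd b e x y < b ^ n"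
proof -
  obtain k where n: "n = Suc (x + k)" using \<open>x < n\<close> less_imp_Suc_add by blast
  have b: "0 < b" using y by simp
  have "e div b ^ Suc x < b ^ k"
    using e by (simp add: n less_mult_imp_div_less power_add algebra_simps)
  then have "Suc (e div b ^ Suc x) * b ^ Suc x \<le> b ^ k * b ^ Suc x"
    by (intro mult_le_mono1) simp
  moreover have "e mod b ^ x + y * b ^ x < b ^ x + y * b ^ x" using b by simp
  moreover have "b ^ x + y * b ^ x \<le> b ^ Suc x"
    using mult_le_mono1[of "Suc y" b "b ^ x"] y by simp
  ultimately show ?thesis by (simp add: upd_def n power_add algebra_simps)
qed

lemma append_digit_less:
  fixes b :: nat
  assumes "h < b ^ t" "v < b"
  shows "h + v * b ^ t < b ^ Suc t"
proof -
  have "h + v * b ^ t < Suc v * b ^ t" using assms(1) by simp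
  also have "\<dots> \<le> b * b ^ t" using assms(2) by (intro mult_le_mono1) simp
  finally show ?thesis by simp
qed

lemma dig_append_digit:
  assumes "h < b ^ t" "v < b" "i \<le> t"
  shows "dig b (h + v * b ^ t) i = (if i = t then v else dig b h i)"
  using dig_split[OF assms(1,2), of 0 i] assms(3) by auto

lemma ex_digits:
  assumes "\<And>i. i < m \<Longrightarrow> f i < b"
  shows "\<exists>g<b ^ m. \<forall>i<m. dig b g i = f i"
  using assms
proof (induction m)
  case (Suc m)
  then obtain g where g: "g < b ^ m" "\<forall>i<m. dig b g i = f i" by fastforce
  have "f m < b" using Suc.prems by simp
  then show ?case
    using append_digit_less[OF g(1)] dig_append_digit[OF g(1)] g(2)
    by (intro exI[of _ "g + f m * b ^ m"]) (auto simp: less_Suc_eq)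
qed simp

section \<open>Extension properties of Urysohn spaces\<close>

lemma one_point_extension:
  fixes M A :: "'a set" and d :: "'a \<Rightarrow> 'a \<Rightarrow> real" and V :: "real set"
  assumes M: "Metric_space M d" and hom: "ultrahomogeneous M d"
    and univ: "\<And>(m::nat) \<rho>. Metric_space {..m} \<rho> \<Longrightarrow> diam_le_1 {..m} \<rho> \<Longrightarrow>
      (\<And>i j. \<rho> i j \<in> V) \<Longrightarrow> \<exists>f. f ` {..m} \<subseteq> M \<and> isometric_on {..m} \<rho> d f"
    and A: "finite A" "A \<subseteq> M"
    and V: "0 \<in> V" "\<And>a b. a \<in> A \<Longrightarrow> b \<in> A \<Longrightarrow> d a b \<in> V" "\<And>a. a \<in> A \<Longrightarrow> g a \<in> V"
    and diam: "\<And>a b. a \<in> A \<Longrightarrow> b \<in> A \<Longrightarrow> d a b \<le> 1"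
    and g: "\<And>a. a \<in> A \<Longrightarrow> 0 \<le> g a" "\<And>a. a \<in> A \<Longrightarrow> g a \<le> 1"
    and lip: "\<And>a b. a \<in> A \<Longrightarrow> b \<in> A \<Longrightarrow> g a \<le> g b + d a b"
    and tri: "\<And>a b. a \<in> A \<Longrightarrow> b \<in> A \<Longrightarrow> d a b \<le> g a + g b"
  shows "\<exists>z\<in>M. \<forall>a\<in>A. d z a = g a"
\<comment> \<open>A value 0 forces the new point to be \<open>a\<close> itself; otherwise adjoining
  a new point yields a genuine metric.\<close>
proof (cases "\<exists>a\<in>A. g a = 0")
  case True
  then obtain a where a: "a \<in> A" "g a = 0" by blast
  have "d a b = g b" if "b \<in> A" for b
    using lip[OF that a(1)] tri[OF a(1) that] a(2) Metric_space.commute[OF M, of a b] by simp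
  then show ?thesis using a(1) A(2) by blast
next
  case False
  interpret Metric_space M d by fact
  define m where "m = card A"
  obtain h where h: "bij_betw h {..<m} A"
    using ex_bij_betw_nat_finite[OF A(1)] by (auto simp: m_def atLeast0LessThan)
  have hA: "h i \<in> A" if "i < m" for i
    using h that by (auto simp: bij_betw_def)
  have hM: "h i \<in> M" if "i < m" for i
    using hA[OF that] A(2) by blast
  have h_eq: "h i = h j \<longleftrightarrow> i = j" if "i < m" "j < m" for i j
    using h that by (auto simp: bij_betw_def inj_on_def)
  have g_pos: "g a > 0" if "a \<in> A" for a
    using g(1)[OF that] False that by force
  \<comment> \<open>The indices below \<open>m\<close> stand for \<open>A\<close>, the index
    \<open>m\<close> for the point to be added.\<close>
  define \<rho> where "\<rho> i j = (if i < m \<and> j < m then d (h i) (h j)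
    else if i < m \<and> j = m then g (h i) else if i = m \<and> j < m then g (h j) else 0)" for i j
  have "Metric_space {..m} \<rho>"
  proof
    fix i j
    show "0 \<le> \<rho> i j" by (auto simp: \<rho>_def g hA)
    show "\<rho> i j = \<rho> j i"
    proof (cases "i < m \<and> j < m")
      case True
      then show ?thesis by (simp only: \<rho>_def simp_thms if_True) (rule commute)
    next
      case False
      then show ?thesis by (cases "i < m"; cases "j < m") (simp_all add: \<rho>_def)
    qed
  next
    fix i j
    assume "i \<in> {..m}" "j \<in> {..m}"
    then show "\<rho> i j = 0 \<longleftrightarrow> i = j"
      using g_pos[OF hA[of i]] g_pos[OF hA[of j]] by (auto simp: \<rho>_def hM h_eq)
  next
    fix i j k
    assume *: "i \<in> {..m}" "j \<in> {..m}" "k \<in> {..m}"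
    then consider "i < m" "j < m" "k < m" | "i < m" "j < m" "k = m" | "i < m" "j = m" "k < m"
      | "i < m" "j = m" "k = m" | "i = m" "j < m" "k < m" | "i = m" "j < m" "k = m"
      | "i = m" "j = m"
      unfolding atMost_iff le_less by blast
    then show "\<rho> i k \<le> \<rho> i j + \<rho> j k"
    proof cases
      case 1 then show ?thesis by (auto simp: \<rho>_def hM triangle)
    next
      case 2 then show ?thesis using lip[of "h i" "h j"] by (auto simp: \<rho>_def hA)
    next
      case 3 then show ?thesis using tri[of "h i" "h k"] by (auto simp: \<rho>_def hA)
    next
      case 4 then show ?thesis by (auto simp: \<rho>_def)
    next
      case 5 then show ?thesis
        using lip[of "h k" "h j"] commute[of "h k" "h j"] by (auto simp: \<rho>_def hA)
    next
      case 6 then show ?thesis using g(1)[of "h j"] by (auto simp: \<rho>_def hA)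
    next
      case 7 then show ?thesis by (auto simp: \<rho>_def)
    qed
  qed
  moreover have "diam_le_1 {..m} \<rho>"
    by (auto simp: diam_le_1_def \<rho>_def diam g hA)
  moreover have "\<rho> i j \<in> V" for i j
    by (auto simp: \<rho>_def V hA)
  ultimately obtain f where f: "f ` {..m} \<subseteq> M" "isometric_on {..m} \<rho> d f"
    using univ by blast
  have iso: "d (f i) (f j) = \<rho> i j" if "i \<le> m" "j \<le> m" for i j
    using f(2) that by (auto simp: isometric_on_def)
  have "inj_on f {..<m}"
  proof (rule inj_onI)
    fix i j
    assume ij: "i \<in> {..<m}" "j \<in> {..<m}" and eq: "f i = f j"
    have "d (f i) (f j) = 0" using f(1) ij eq by (auto simp: image_subset_iff)
    then have "d (h i) (h j) = 0" using ij iso[of i j] by (simp add: \<rho>_def)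
    then show "i = j" using ij hM h_eq by auto
  qed
  then have inv: "inv_into {..<m} f (f i) = i" if "i < m" for i
    using that by (auto intro: inv_into_f_f)
  \<comment> \<open>This isometry takes the embedded copy of \<open>A\<close> back to
    \<open>A\<close>; its extension \<open>G\<close> takes \<open>f m\<close> to the required
    point.\<close>
  define k where "k = h \<circ> inv_into {..<m} f"
  have k: "k (f i) = h i" if "i < m" for i
    using that by (simp add: k_def inv)
  have "isometric_on (f ` {..<m}) d d k"
    using iso by (auto simp: isometric_on_def k \<rho>_def)
  moreover have "f ` {..<m} \<subseteq> M" "k ` f ` {..<m} \<subseteq> M"
    using f(1) hM k by (auto simp: image_subset_iff)
  ultimately obtain G where G: "bij_betw G M M" "isometric_on M d d G"
      "\<forall>x\<in>f ` {..<m}. G x = k x"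
    using hom[unfolded ultrahomogeneous_def, rule_format, of "f ` {..<m}" k] by auto
  have fm: "f m \<in> M" using f(1) by auto
  have "d (G (f m)) a = g a" if a: "a \<in> A" for a
  proof -
    obtain i where i: "i < m" "a = h i"
      using a unfolding bij_betw_imp_surj_on[OF h, symmetric] by blast
    have "a = G (f i)" using i G(3) k by simp
    then have "d (G (f m)) a = d (f m) (f i)"
      using G(2) fm f(1) i(1) by (auto simp: isometric_on_def image_subset_iff)
    then show ?thesis using iso[of m i] i by (simp add: \<rho>_def)
  qed
  moreover have "G (f m) \<in> M" using G(1) fm by (auto simp: bij_betw_def)
  ultimately show ?thesis by blast
qed

lemma finite_polish_metric:
  assumes "Metric_space M \<rho>" "finite M"
  shows "polish_metric M \<rho>"
proof -
  interpret Metric_space M \<rho> by fact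
  have "compact_space mtopology"
    using assms(2) by (simp add: compact_space_def finite_imp_compactin)
  then have "mcomplete" by (rule compact_space_imp_mcomplete)
  moreover have "separable_space mtopology"
    unfolding separable_space_def
    by (rule exI[of _ M]) (use assms(2) in \<open>auto simp: countable_finite closure_of_topspace[of mtopology, simplified]\<close>)
  ultimately show ?thesis using assms(1) by (simp add: polish_metric_def)
qed

lemma urysohn_space_embeds_finite:
  fixes \<rho> :: "nat \<Rightarrow> nat \<Rightarrow> real"
  assumes U: "urysohn_space U d" and \<rho>: "Metric_space {..m} \<rho>" "diam_le_1 {..m} \<rho>"
  shows "\<exists>f. f ` {..m} \<subseteq> U \<and> isometric_on {..m} \<rho> d f"
proof -
  \<comment> \<open>Universality of \<open>U\<close> speaks of carriers in the reals, so the metric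
    is transported along \<open>real\<close>, which the floor inverts.\<close>
  define \<rho>' where "\<rho>' x y = \<rho> (nat \<lfloor>x\<rfloor>) (nat \<lfloor>y\<rfloor>)" for x y :: real
  interpret Metric_space "{..m}" \<rho> by fact
  have "Metric_space (real ` {..m}) \<rho>'"
    by standard (auto simp: \<rho>'_def intro: commute triangle)
  then have "polish_metric (real ` {..m}) \<rho>'" by (simp add: finite_polish_metric)
  moreover have "diam_le_1 (real ` {..m}) \<rho>'"
    using \<rho>(2) by (auto simp: diam_le_1_def \<rho>'_def)
  ultimately obtain f where "f ` real ` {..m} \<subseteq> U" "isometric_on (real ` {..m}) \<rho>' d f"
    using U unfolding urysohn_space_def by blast
  then show ?thesis
    by (intro exI[of _ "f \<circ> real"]) (auto simp: isometric_on_def \<rho>'_def)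
qed

section \<open>Continuous formulas\<close>

fun tconsts :: "cterm \<Rightarrow> nat set" where
  "tconsts (Var x) = {}"
| "tconsts (Const i) = {i}"

fun fconsts :: "cform \<Rightarrow> nat set" where
  "fconsts (FDist t u) = tconsts t \<union> tconsts u"
| "fconsts FZero = {}"
| "fconsts FOne = {}"
| "fconsts (FHalf \<phi>) = fconsts \<phi>"
| "fconsts (FMonus \<phi> \<psi>) = fconsts \<phi> \<union> fconsts \<psi>"
| "fconsts (FMin \<phi> \<psi>) = fconsts \<phi> \<union> fconsts \<psi>"
| "fconsts (FMax \<phi> \<psi>) = fconsts \<phi> \<union> fconsts \<psi>"
| "fconsts (FAbsDiff \<phi> \<psi>) = fconsts \<phi> \<union> fconsts \<psi>"
| "fconsts (FNeg \<phi>) = fconsts \<phi>"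
| "fconsts (FPlus \<phi> \<psi>) = fconsts \<phi> \<union> fconsts \<psi>"
| "fconsts (FSup x \<phi>) = fconsts \<phi>"
| "fconsts (FInf x \<phi>) = fconsts \<phi>"

lemma tval_cong_consts: "(\<And>i. i \<in> tconsts t \<Longrightarrow> s i = s' i) \<Longrightarrow> tval s e t = tval s' e t"
  by (cases t) auto

lemma fval_cong_consts:
  assumes "\<And>i. i \<in> fconsts \<phi> \<Longrightarrow> s i = s' i"
  shows "fval M d s e \<phi> = fval M d s' e \<phi>"
  using assms
proof (induction \<phi> arbitrary: e)
  case (FDist t u)
  have "tval s e t = tval s' e t" "tval s e u = tval s' e u"
    by (rule tval_cong_consts; use FDist in simp)+
  then show ?case by simp
qed auto

text \<open>A Lipschitz constant for the supremum distance of assignments. It is crude on purpose: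
  halving does not improve it and all binary connectives add, so it stays a natural number bounded
  linearly in the code.\<close>

fun lipschitz :: "cform \<Rightarrow> nat" where
  "lipschitz (FDist t u) = 2"
| "lipschitz FZero = 0"
| "lipschitz FOne = 0"
| "lipschitz (FHalf \<phi>) = lipschitz \<phi>"
| "lipschitz (FMonus \<phi> \<psi>) = lipschitz \<phi> + lipschitz \<psi>"
| "lipschitz (FMin \<phi> \<psi>) = lipschitz \<phi> + lipschitz \<psi>"
| "lipschitz (FMax \<phi> \<psi>) = lipschitz \<phi> + lipschitz \<psi>"
| "lipschitz (FAbsDiff \<phi> \<psi>) = lipschitz \<phi> + lipschitz \<psi>"
| "lipschitz (FNeg \<phi>) = lipschitz \<phi>"
| "lipschitz (FPlus \<phi> \<psi>) = lipschitz \<phi> + lipschitz \<psi>"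
| "lipschitz (FSup x \<phi>) = lipschitz \<phi>"
| "lipschitz (FInf x \<phi>) = lipschitz \<phi>"

lemma abs_cSUP_diff_le:
  fixes f g :: "'a \<Rightarrow> real"
  assumes "A \<noteq> {}" "bdd_above (f ` A)" "bdd_above (g ` A)" "\<And>a. a \<in> A \<Longrightarrow> \<bar>f a - g a\<bar> \<le> c"
  shows "\<bar>(SUP a\<in>A. f a) - (SUP a\<in>A. g a)\<bar> \<le> c"
proof -
  have "(SUP a\<in>A. f a) \<le> (SUP a\<in>A. g a) + c"
    using assms(1)
  proof (rule cSUP_least)
    fix a assume "a \<in> A"
    then show "f a \<le> (SUP a\<in>A. g a) + c"
      using cSUP_upper[OF _ assms(3), of a] assms(4)[of a] by linarith
  qed
  moreover have "(SUP a\<in>A. g a) \<le> (SUP a\<in>A. f a) + c"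
    using assms(1)
  proof (rule cSUP_least)
    fix a assume "a \<in> A"
    then show "g a \<le> (SUP a\<in>A. f a) + c"
      using cSUP_upper[OF _ assms(2), of a] assms(4)[of a] by linarith
  qed
  ultimately show ?thesis by linarith
qed

lemma abs_cINF_diff_le:
  fixes f g :: "'a \<Rightarrow> real"
  assumes "A \<noteq> {}" "bdd_below (f ` A)" "bdd_below (g ` A)" "\<And>a. a \<in> A \<Longrightarrow> \<bar>f a - g a\<bar> \<le> c"
  shows "\<bar>(INF a\<in>A. f a) - (INF a\<in>A. g a)\<bar> \<le> c"
proof -
  have "(INF a\<in>A. g a) - c \<le> (INF a\<in>A. f a)"
    using assms(1)
  proof (rule cINF_greatest)
    fix a assume "a \<in> A"
    then show "(INF a\<in>A. g a) - c \<le> f a"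
      using cINF_lower[OF assms(3), of a] assms(4)[of a] by linarith
  qed
  moreover have "(INF a\<in>A. f a) - c \<le> (INF a\<in>A. g a)"
    using assms(1)
  proof (rule cINF_greatest)
    fix a assume "a \<in> A"
    then show "(INF a\<in>A. f a) - c \<le> g a"
      using cINF_lower[OF assms(2), of a] assms(4)[of a] by linarith
  qed
  ultimately show ?thesis by linarith
qed

lemma abs_monus_diff_le: "\<bar>max (a - b) 0 - max (a' - b') 0\<bar> \<le> \<bar>a - a'\<bar> + \<bar>b - b'\<bar>" for a :: real
  by linarith

lemma abs_min_diff_le: "\<bar>min a b - min a' b'\<bar> \<le> \<bar>a - a'\<bar> + \<bar>b - b'\<bar>" for a :: real
  by linarith

lemma abs_max_diff_le: "\<bar>max a b - max a' b'\<bar> \<le> \<bar>a - a'\<bar> + \<bar>b - b'\<bar>" for a :: real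
  by linarith

lemma abs_absdiff_diff_le: "\<bar>\<bar>a - b\<bar> - \<bar>a' - b'\<bar>\<bar> \<le> \<bar>a - a'\<bar> + \<bar>b - b'\<bar>" for a :: real
  by linarith

lemma abs_plus_diff_le: "\<bar>min (a + b) c - min (a' + b') c\<bar> \<le> \<bar>a - a'\<bar> + \<bar>b - b'\<bar>" for a :: real
  by linarith

section \<open>Geometry of \<open>U\<close> and continuity of formulas in types\<close>

locale urysohn_presentation =
  fixes U QU :: "'a set" and d :: "'a \<Rightarrow> 'a \<Rightarrow> real" and s :: "nat \<Rightarrow> 'a"
  assumes urysohn: "urysohn_space U d"
    and rational_urysohn: "rational_urysohn_space QU d"
    and QU_subset: "QU \<subseteq> U"
    and presentation: "decidable_presentation QU d s"
begin

sublocale Metric_space U d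
  using urysohn by (simp add: urysohn_space_def polish_metric_def)

lemma s_QU: "s i \<in> QU"
  using presentation by (auto simp: decidable_presentation_def bij_betw_def)

lemma s_U [simp]: "s i \<in> U"
  using s_QU QU_subset by blast

lemma U_nonempty: "U \<noteq> {}"
  using s_U by blast

lemma d_le_1: "x \<in> U \<Longrightarrow> y \<in> U \<Longrightarrow> d x y \<le> 1"
  using urysohn by (auto simp: urysohn_space_def diam_le_1_def)

lemma d_rational: "d (s i) (s j) \<in> \<rat>"
  using rational_urysohn s_QU by (auto simp: rational_urysohn_space_def rational_distances_def)

lemma U_extension:
  assumes "finite A" "A \<subseteq> U"
    and "\<And>a. a \<in> A \<Longrightarrow> 0 \<le> g a" "\<And>a. a \<in> A \<Longrightarrow> g a \<le> 1"
    and "\<And>a b. a \<in> A \<Longrightarrow> b \<in> A \<Longrightarrow> g a \<le> g b + d a b"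
    and "\<And>a b. a \<in> A \<Longrightarrow> b \<in> A \<Longrightarrow> d a b \<le> g a + g b"
  shows "\<exists>z\<in>U. \<forall>a\<in>A. d z a = g a"
proof (rule one_point_extension[where V = UNIV])
  show "ultrahomogeneous U d" using urysohn by (simp add: urysohn_space_def)
qed (use assms d_le_1 urysohn_space_embeds_finite[OF urysohn] in
    \<open>auto simp: Metric_space_axioms subset_iff\<close>)

lemma QU_extension:
  assumes g: "\<And>i. i < m \<Longrightarrow> 0 \<le> g i" "\<And>i. i < m \<Longrightarrow> g i \<le> 1" "\<And>i. i < m \<Longrightarrow> g i \<in> \<rat>"
    and lip: "\<And>i j. i < m \<Longrightarrow> j < m \<Longrightarrow> g i \<le> g j + d (s i) (s j)"
    and tri: "\<And>i j. i < m \<Longrightarrow> j < m \<Longrightarrow> d (s i) (s j) \<le> g i + g j"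
  shows "\<exists>y. \<forall>i<m. d (s y) (s i) = g i"
proof -
  have bij: "bij_betw s UNIV QU"
    using presentation by (simp add: decidable_presentation_def)
  then have inv: "inv s (s i) = i" for i
    by (auto simp: bij_betw_def inv_f_f)
  have "\<exists>z\<in>QU. \<forall>a\<in>s ` {..<m}. d z a = g (inv s a)"
  proof (rule one_point_extension[where V = \<rat>])
    show "Metric_space QU d" "ultrahomogeneous QU d"
      using rational_urysohn by (simp_all add: rational_urysohn_space_def)
  next
    fix m' :: nat and \<rho>
    assume "Metric_space {..m'} \<rho>" "diam_le_1 {..m'} \<rho>" "\<And>i j. \<rho> i j \<in> \<rat>"
    then show "\<exists>f. f ` {..m'} \<subseteq> QU \<and> isometric_on {..m'} \<rho> d f"
      using rational_urysohn by (auto simp: rational_urysohn_space_def rational_distances_def)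
  qed (auto simp: s_QU inv d_rational g lip tri d_le_1)
  then obtain z where "z \<in> QU" and z: "\<forall>i<m. d z (s i) = g i"
    by (auto simp: inv)
  moreover obtain y where "z = s y"
    using bij \<open>z \<in> QU\<close> by (auto simp: bij_betw_def)
  ultimately show ?thesis by blast
qed

text \<open>A point \<open>x'\<close> is adjoined that has the distances of \<open>x\<close> to
  \<open>A\<close> and lies as near to \<open>y\<close> as these allow. Sending \<open>x\<close> to
  \<open>x'\<close> and fixing \<open>A\<close> is a finite isometry, hence extends to an
  automorphism.\<close>

lemma near_conjugate:
  assumes A: "finite A" "A \<subseteq> U" and x: "x \<in> U" and y: "y \<in> U" and \<epsilon>: "0 \<le> \<epsilon>"
    and close: "\<And>a. a \<in> A \<Longrightarrow> \<bar>d x a - d y a\<bar> \<le> \<epsilon>"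
  shows "\<exists>G. bij_betw G U U \<and> isometric_on U d d G \<and> (\<forall>a\<in>A. G a = a) \<and> d (G x) y \<le> \<epsilon>"
\<comment> \<open>For \<open>y\<close> in \<open>A\<close> the hypothesis at \<open>y\<close>
  already bounds \<open>d x y\<close>, and prescribing a new distance to \<open>y\<close> would
  conflict with the old one.\<close>
proof (cases "y \<in> A")
  case True
  then have "d x y \<le> \<epsilon>" using close[of y] y by simp
  then show ?thesis by (intro exI[of _ id]) (auto simp: isometric_on_def)
next
  case False
  \<comment> \<open>The least distance from \<open>y\<close> that the triangle inequality leaves to
    a point with the distances of \<open>x\<close> to \<open>A\<close>; the inserted 0 covers empty
    \<open>A\<close>.\<close>
  define \<delta> where "\<delta> = Max (insert 0 ((\<lambda>a. \<bar>d x a - d y a\<bar>) ` A))"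
  have \<delta>_ge: "\<bar>d x a - d y a\<bar> \<le> \<delta>" if "a \<in> A" for a
    using A(1) that by (auto simp: \<delta>_def)
  have \<delta>0: "0 \<le> \<delta>" using A(1) by (auto simp: \<delta>_def)
  have \<delta>_le: "\<delta> \<le> b" if "0 \<le> b" "\<And>a. a \<in> A \<Longrightarrow> \<bar>d x a - d y a\<bar> \<le> b" for b
    using A(1) that by (auto simp: \<delta>_def)
  have AU: "a \<in> U" if "a \<in> A" for a using A(2) that by blast
  \<comment> \<open>From this come both upper constraints on \<delta>: the bound by
    \<open>d x a + d y a\<close> and the bound by 1.\<close>
  have \<delta>_xy: "\<delta> \<le> d x y"
  proof (rule \<delta>_le)
    fix a assume "a \<in> A"
    then show "\<bar>d x a - d y a\<bar> \<le> d x y"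
      using triangle[OF x y AU] triangle[OF y x AU] commute[of x y] by fastforce
  qed simp
  have tri: "\<delta> \<le> d x a + d y a" if "a \<in> A" for a
    using \<delta>_xy triangle[OF x AU[OF that] y] commute[of y a] by linarith
  define g where "g a = (if a = y then \<delta> else d x a)" for a
  have "\<exists>z\<in>U. \<forall>a\<in>insert y A. d z a = g a"
  proof (rule U_extension)
    fix a b
    assume ab: "a \<in> insert y A" "b \<in> insert y A"
    consider "a = y" "b = y" | "a = y" "b \<noteq> y" "b \<in> A" | "a \<noteq> y" "a \<in> A" "b = y"
      | "a \<noteq> y" "b \<noteq> y" "a \<in> A" "b \<in> A"
      using ab by blast
    then show "g a \<le> g b + d a b"
    proof cases
      case 1 then show ?thesis by (simp add: g_def)
    next
      case 2 then show ?thesis using tri[of b] by (simp add: g_def)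
    next
      case 3 then show ?thesis using \<delta>_ge[of a] commute[of a y] by (auto simp: g_def)
    next
      case 4 then show ?thesis
        using triangle[OF x AU[of b] AU[of a]] commute[of a b] by (simp add: g_def)
    qed
    consider "a = y" "b = y" | "a = y" "b \<noteq> y" "b \<in> A" | "a \<noteq> y" "a \<in> A" "b = y"
      | "a \<noteq> y" "b \<noteq> y" "a \<in> A" "b \<in> A"
      using ab by blast
    then show "d a b \<le> g a + g b"
    proof cases
      case 1 then show ?thesis using \<delta>0 y by (simp add: g_def)
    next
      case 2 then show ?thesis using \<delta>_ge[of b] by (auto simp: g_def)
    next
      case 3 then show ?thesis using \<delta>_ge[of a] commute[of a y] by (auto simp: g_def)
    next
      case 4 then show ?thesis
        using triangle[OF AU[of a] x AU[of b]] commute[of a x] by (simp add: g_def)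
    qed
  next
    fix a
    assume "a \<in> insert y A"
    then show "g a \<le> 1"
      using \<delta>_xy d_le_1[OF x y] d_le_1[OF x AU[of a]] by (auto simp: g_def)
  qed (use A y \<delta>0 in \<open>auto simp: g_def\<close>)
  then obtain x' where x': "x' \<in> U" "d x' y = \<delta>" "\<And>a. a \<in> A \<Longrightarrow> d x' a = d x a"
    using False by (fastforce simp: g_def)
  define f where "f z = (if z = x then x' else z)" for z
  \<comment> \<open>If \<open>x\<close> itself lies in \<open>A\<close>, then
    \<open>d x' x = d x x = 0\<close>, so \<open>x' = x\<close>.\<close>
  have fA: "f a = a" if "a \<in> A" for a
    using x'(3)[OF that] x'(1) x AU[OF that] by (auto simp: f_def)
  have "isometric_on (insert x A) d d f"
    unfolding isometric_on_def
  proof (intro ballI)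
    fix a b
    assume "a \<in> insert x A" "b \<in> insert x A"
    then show "d (f a) (f b) = d a b"
      using x' x fA[of a] fA[of b] commute[of a x] commute[of a x']
      by (cases "a = x"; cases "b = x") (auto simp: f_def)
  qed
  moreover have "finite (insert x A)" "insert x A \<subseteq> U" "f ` insert x A \<subseteq> U"
    using A x x'(1) by (auto simp: f_def)
  ultimately obtain G where G: "bij_betw G U U" "isometric_on U d d G" "\<forall>z\<in>insert x A. G z = f z"
    using urysohn unfolding urysohn_space_def ultrahomogeneous_def by meson
  have "d (G x) y \<le> \<epsilon>"
    using G(3) x'(2) \<delta>_le[OF \<epsilon> close] by (auto simp: f_def)
  then show ?thesis using G fA by auto
qed

lemma tval_in_U [simp]: "(\<And>x. e x \<in> U) \<Longrightarrow> tval s e t \<in> U"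
  by (cases t) auto

text \<open>Boundedness is what makes the suprema and infima of reals in \<open>fval\<close>
  meaningful.\<close>

lemma fval_in_unit:
  assumes "\<And>x. e x \<in> U"
  shows "0 \<le> fval U d s e \<phi> \<and> fval U d s e \<phi> \<le> 1"
  using assms
proof (induction \<phi> arbitrary: e)
  case (FDist t u)
  then show ?case using d_le_1 by simp
next
  case (FMonus \<phi> \<psi>)
  from FMonus.IH[of e] FMonus.prems show ?case by force
next
  case (FMin \<phi> \<psi>)
  from FMin.IH[of e] FMin.prems show ?case by force
next
  case (FMax \<phi> \<psi>)
  from FMax.IH[of e] FMax.prems show ?case by force
next
  case (FAbsDiff \<phi> \<psi>)
  from FAbsDiff.IH[of e] FAbsDiff.prems show ?case by force
next
  case (FPlus \<phi> \<psi>)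
  from FPlus.IH[of e] FPlus.prems show ?case by force
next
  case (FHalf \<phi>)
  from FHalf.IH[of e] FHalf.prems show ?case by force
next
  case (FSup x \<phi>)
  have *: "0 \<le> fval U d s (e(x := a)) \<phi> \<and> fval U d s (e(x := a)) \<phi> \<le> 1" if "a \<in> U" for a
    using FSup.prems that by (intro FSup.IH) auto
  obtain a where a: "a \<in> U" using U_nonempty by blast
  have "0 \<le> (SUP a\<in>U. fval U d s (e(x := a)) \<phi>)"
    by (rule cSUP_upper2[OF _ a]) (use * a in \<open>auto intro!: bdd_aboveI2[of _ _ 1]\<close>)
  moreover have "(SUP a\<in>U. fval U d s (e(x := a)) \<phi>) \<le> 1"
    by (rule cSUP_least[OF U_nonempty]) (use * in auto)
  ultimately show ?case by simp
next
  case (FInf x \<phi>)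
  have *: "0 \<le> fval U d s (e(x := a)) \<phi> \<and> fval U d s (e(x := a)) \<phi> \<le> 1" if "a \<in> U" for a
    using FInf.prems that by (intro FInf.IH) auto
  obtain a where a: "a \<in> U" using U_nonempty by blast
  have "(INF a\<in>U. fval U d s (e(x := a)) \<phi>) \<le> 1"
    by (rule cINF_lower2[OF _ a]) (use * a in \<open>auto intro!: bdd_belowI2[of _ 0]\<close>)
  moreover have "0 \<le> (INF a\<in>U. fval U d s (e(x := a)) \<phi>)"
    by (rule cINF_greatest[OF U_nonempty]) (use * in auto)
  ultimately show ?case by simp
qed simp_all

lemma fval_bdd:
  assumes "\<And>x. e x \<in> U"
  shows "bdd_above ((\<lambda>a. fval U d s (e(x := a)) \<phi>) ` U)"
    and "bdd_below ((\<lambda>a. fval U d s (e(x := a)) \<phi>) ` U)"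
  using fval_in_unit[of "e(x := _)" \<phi>] assms
  by (auto intro!: bdd_aboveI2[of _ _ 1] bdd_belowI2[of _ 0])

lemma fval_lipschitz:
  fixes \<delta> :: real
  assumes "\<And>x. e x \<in> U" "\<And>x. e' x \<in> U" "\<And>x. d (e x) (e' x) \<le> \<delta>"
  shows "\<bar>fval U d s e \<phi> - fval U d s e' \<phi>\<bar> \<le> lipschitz \<phi> * \<delta>"
  using assms
proof (induction \<phi> arbitrary: e e')
  case (FDist t u)
  have \<delta>: "0 \<le> \<delta>" using nonneg[of "e 0" "e' 0"] FDist(3)[of 0] by linarith
  have *: "d (tval s e v) (tval s e' v) \<le> \<delta>" "tval s e v \<in> U" "tval s e' v \<in> U" for v
    using FDist \<delta> by (cases v; simp)+
  have "d (tval s e t) (tval s e u) \<le>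
      d (tval s e t) (tval s e' t) + d (tval s e' t) (tval s e' u) + d (tval s e' u) (tval s e u)"
    using triangle[of "tval s e t" "tval s e' t" "tval s e u"]
      triangle[of "tval s e' t" "tval s e' u" "tval s e u"] * by force
  moreover have "d (tval s e' t) (tval s e' u) \<le>
      d (tval s e' t) (tval s e t) + d (tval s e t) (tval s e u) + d (tval s e u) (tval s e' u)"
    using triangle[of "tval s e' t" "tval s e t" "tval s e' u"]
      triangle[of "tval s e t" "tval s e u" "tval s e' u"] * by force
  ultimately show ?case
    using *(1)[of t] *(1)[of u] commute[of "tval s e' t" "tval s e t"]
      commute[of "tval s e' u" "tval s e u"] by simp
next
  case (FSup x \<phi>)
  \<comment> \<open>After the update both assignments agree at \<open>x\<close>, where the
    hypothesis of the induction becomes \<open>0 \<le> \<delta>\<close>.\<close>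
  have \<delta>: "0 \<le> \<delta>" using nonneg[of "e 0" "e' 0"] FSup.prems(3)[of 0] by linarith
  show ?case unfolding fval.simps lipschitz.simps
    by (intro abs_cSUP_diff_le U_nonempty fval_bdd FSup.IH) (use FSup.prems \<delta> in auto)
next
  case (FInf x \<phi>)
  have \<delta>: "0 \<le> \<delta>" using nonneg[of "e 0" "e' 0"] FInf.prems(3)[of 0] by linarith
  show ?case unfolding fval.simps lipschitz.simps
    by (intro abs_cINF_diff_le U_nonempty fval_bdd FInf.IH) (use FInf.prems \<delta> in auto)
next
  case (FHalf \<phi>)
  then show ?case using FHalf.IH[of e e'] by fastforce
next
  case (FMonus \<phi> \<psi>)
  show ?case unfolding fval.simps lipschitz.simps of_nat_add distrib_right
    by (rule order_trans[OF abs_monus_diff_le add_mono[OF FMonus.IH[OF FMonus.prems]]])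
next
  case (FMin \<phi> \<psi>)
  show ?case unfolding fval.simps lipschitz.simps of_nat_add distrib_right
    by (rule order_trans[OF abs_min_diff_le add_mono[OF FMin.IH[OF FMin.prems]]])
next
  case (FMax \<phi> \<psi>)
  show ?case unfolding fval.simps lipschitz.simps of_nat_add distrib_right
    by (rule order_trans[OF abs_max_diff_le add_mono[OF FMax.IH[OF FMax.prems]]])
next
  case (FAbsDiff \<phi> \<psi>)
  show ?case unfolding fval.simps lipschitz.simps of_nat_add distrib_right
    by (rule order_trans[OF abs_absdiff_diff_le add_mono[OF FAbsDiff.IH[OF FAbsDiff.prems]]])
next
  case (FNeg \<phi>)
  from FNeg.IH[of e e'] FNeg.prems show ?case by (simp add: abs_minus_commute)
next
  case (FPlus \<phi> \<psi>)
  show ?case unfolding fval.simps lipschitz.simps of_nat_add distrib_right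
    by (rule order_trans[OF abs_plus_diff_le add_mono[OF FPlus.IH[OF FPlus.prems]]])
qed simp_all

text \<open>The constants have to move along with the assignment; at a quantifier the range is
  reindexed by the surjection \<open>G\<close>.\<close>

lemma fval_automorphism:
  assumes G: "bij_betw G U U" "isometric_on U d d G" and "\<And>x. e x \<in> U"
  shows "fval U d (G \<circ> s) (G \<circ> e) \<phi> = fval U d s e \<phi>"
  using assms(3)
proof (induction \<phi> arbitrary: e)
  case (FDist t u)
  have "tval (G \<circ> s) (G \<circ> e) v = G (tval s e v)" for v by (cases v) auto
  moreover have "tval s e v \<in> U" for v using FDist by simp
  ultimately show ?case using G(2) by (simp add: isometric_on_def del: comp_apply)
next
  case (FSup x \<phi>)
  have "fval U d (G \<circ> s) ((G \<circ> e)(x := G b)) \<phi> = fval U d s (e(x := b)) \<phi>" if "b \<in> U" for b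
    unfolding fun_upd_comp[symmetric] by (rule FSup.IH) (use FSup.prems that in auto)
  then have "(\<lambda>a. fval U d (G \<circ> s) ((G \<circ> e)(x := a)) \<phi>) ` G ` U =
      (\<lambda>a. fval U d s (e(x := a)) \<phi>) ` U"
    unfolding image_image by (rule image_cong[OF refl])
  moreover have "G ` U = U" using G(1) by (simp add: bij_betw_def)
  ultimately show ?case by (simp only: fval.simps)
next
  case (FInf x \<phi>)
  have "fval U d (G \<circ> s) ((G \<circ> e)(x := G b)) \<phi> = fval U d s (e(x := b)) \<phi>" if "b \<in> U" for b
    unfolding fun_upd_comp[symmetric] by (rule FInf.IH) (use FInf.prems that in auto)
  then have "(\<lambda>a. fval U d (G \<circ> s) ((G \<circ> e)(x := a)) \<phi>) ` G ` U =
      (\<lambda>a. fval U d s (e(x := a)) \<phi>) ` U"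
    unfolding image_image by (rule image_cong[OF refl])
  moreover have "G ` U = U" using G(1) by (simp add: bij_betw_def)
  ultimately show ?case by (simp only: fval.simps)
qed simp_all

text \<open>An automorphism fixing the first \<open>m\<close> points fixes the constants and the
  other free variables of the formula, so it replaces \<open>a\<close> by a point within \<epsilon>
  of \<open>b\<close> without changing the value. Closeness of types thereby does the work of
  closeness of points.\<close>

lemma fval_near_type:
  fixes \<epsilon> :: real
  assumes e: "\<And>z. e z \<in> U" and a: "a \<in> U" and b: "b \<in> U" and \<epsilon>: "0 \<le> \<epsilon>"
    and cs: "fconsts \<phi> \<subseteq> {..<m}" and vars: "\<And>z. z \<in> fvars \<phi> - {x} \<Longrightarrow> e z \<in> s ` {..<m}"
    and close: "\<And>i. i < m \<Longrightarrow> \<bar>d a (s i) - d b (s i)\<bar> \<le> \<epsilon>"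
  shows "\<bar>fval U d s (e(x := a)) \<phi> - fval U d s (e(x := b)) \<phi>\<bar> \<le> lipschitz \<phi> * \<epsilon>"
proof -
  obtain G where G: "bij_betw G U U" "isometric_on U d d G" "\<forall>c\<in>s ` {..<m}. G c = c"
      "d (G a) b \<le> \<epsilon>"
    using near_conjugate[of "s ` {..<m}" a b \<epsilon>] a b \<epsilon> close by (auto simp: image_subset_iff)
  have Ga: "G a \<in> U" using G(1) a by (auto simp: bij_betw_def)
  have "fval U d s (e(x := a)) \<phi> = fval U d (G \<circ> s) (G \<circ> e(x := a)) \<phi>"
    by (rule fval_automorphism[OF G(1,2), symmetric]) (use e a in simp)
  also have "\<dots> = fval U d s (G \<circ> e(x := a)) \<phi>"
    by (rule fval_cong_consts) (use cs G(3) in auto)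
  also have "\<dots> = fval U d s (e(x := G a)) \<phi>"
    by (rule fval_cong) (use vars G(3) in fastforce)
  finally show ?thesis
    using fval_lipschitz[of "e(x := G a)" "e(x := b)" \<epsilon> \<phi>] e Ga b G(4) \<epsilon> by simp
qed

end

section \<open>A recursive evaluator\<close>

text \<open>The minimisation computes the maximum of the \<open>f y\<close>. It is attained at an
  actual point, so the lower estimate costs only \<open>c\<close>; the upper one also pays the net
  error.\<close>

lemma Least_all_less_approximates_SUP:
  fixes F :: "'a \<Rightarrow> real" and f :: "nat \<Rightarrow> nat"
  assumes bdd: "bdd_above (F ` U)" and p: "\<And>y. p y \<in> U" and K: "0 < K"
    and f: "\<And>y. y < K \<Longrightarrow> \<bar>real S * F (p y) - f y\<bar> \<le> c"
    and net: "\<And>a. a \<in> U \<Longrightarrow> \<exists>y<K. real S * \<bar>F a - F (p y)\<bar> \<le> \<delta>" and S: "0 < S"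
  shows "\<bar>real S * (SUP a\<in>U. F a) - (LEAST v. \<forall>y<K. f y \<le> v)\<bar> \<le> c + \<delta>"
proof -
  define v where "v = (LEAST v. \<forall>y<K. f y \<le> v)"
  have "\<forall>y<K. f y \<le> Max (f ` {..<K})" by auto
  then have up: "\<forall>y<K. f y \<le> v" unfolding v_def by (rule LeastI)
  \<comment> \<open>Otherwise \<open>v - 1\<close> would still be an upper bound;
    \<open>K > 0\<close> excludes \<open>v = 0\<close>.\<close>
  have "\<exists>y<K. f y = v"
  proof (rule ccontr)
    assume "\<not> (\<exists>y<K. f y = v)"
    then have lt: "\<forall>y<K. f y < v" using up by (auto simp: le_less)
    then have "\<forall>y<K. f y \<le> v - 1" by auto
    then have "v \<le> v - 1" unfolding v_def by (rule Least_le)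
    then show False using lt K by auto
  qed
  then obtain y where y: "y < K" "f y = v" by blast
  have \<delta>: "0 \<le> \<delta>"
    using net[OF p, of 0] by (meson abs_ge_zero mult_nonneg_nonneg of_nat_0_le_iff order_trans)
  have "F (p y) \<le> (SUP a\<in>U. F a)" by (rule cSUP_upper[OF p bdd])
  then have "real S * F (p y) \<le> real S * (SUP a\<in>U. F a)" by (simp add: mult_left_mono)
  then have lower: "v - c \<le> real S * (SUP a\<in>U. F a)" using f[OF y(1)] y(2) by linarith
  have "(SUP a\<in>U. F a) \<le> (v + c + \<delta>) / S"
  proof (rule cSUP_least)
    fix a assume "a \<in> U"
    then obtain z where z: "z < K" "real S * \<bar>F a - F (p z)\<bar> \<le> \<delta>" using net by blast
    have "real S * (F a - F (p z)) \<le> real S * \<bar>F a - F (p z)\<bar>" by (intro mult_left_mono) auto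
    then have "real S * F a \<le> real S * F (p z) + \<delta>" using z(2) by (simp add: right_diff_distrib)
    moreover have "real (f z) \<le> v" using up z(1) by simp
    ultimately have "real S * F a \<le> v + c + \<delta>" using f[OF z(1)] by linarith
    then show "F a \<le> (v + c + \<delta>) / S" using S by (simp add: pos_le_divide_eq mult.commute)
  qed (use p in blast)
  then have "real S * (SUP a\<in>U. F a) \<le> v + c + \<delta>"
    using S by (simp add: pos_le_divide_eq mult.commute)
  then show ?thesis using lower \<delta> unfolding v_def by linarith
qed

text \<open>Dual to the supremum: the least number above some \<open>f y\<close> is their
  minimum.\<close>

lemma Least_ex_less_approximates_INF:
  fixes F :: "'a \<Rightarrow> real" and f :: "nat \<Rightarrow> nat"
  assumes bdd: "bdd_below (F ` U)" and p: "\<And>y. p y \<in> U" and K: "0 < K"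
    and f: "\<And>y. y < K \<Longrightarrow> \<bar>real S * F (p y) - f y\<bar> \<le> c"
    and net: "\<And>a. a \<in> U \<Longrightarrow> \<exists>y<K. real S * \<bar>F a - F (p y)\<bar> \<le> \<delta>" and S: "0 < S"
  shows "\<bar>real S * (INF a\<in>U. F a) - (LEAST v. \<exists>y<K. f y \<le> v)\<bar> \<le> c + \<delta>"
proof -
  define v where "v = (LEAST v. \<exists>y<K. f y \<le> v)"
  have "\<exists>y<K. f y \<le> f 0" using K by blast
  then have "\<exists>y<K. f y \<le> v" unfolding v_def by (rule LeastI)
  then obtain y where y: "y < K" "f y \<le> v" by blast
  have low: "v \<le> f z" if "z < K" for z
    unfolding v_def by (rule Least_le) (use that in blast)
  have \<delta>: "0 \<le> \<delta>"
    using net[OF p, of 0] by (meson abs_ge_zero mult_nonneg_nonneg of_nat_0_le_iff order_trans)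
  have "(INF a\<in>U. F a) \<le> F (p y)" by (rule cINF_lower[OF bdd p])
  then have "real S * (INF a\<in>U. F a) \<le> real S * F (p y)" by (simp add: mult_left_mono)
  moreover have "real (f y) \<le> v" using y(2) by simp
  ultimately have upper: "real S * (INF a\<in>U. F a) \<le> v + c" using f[OF y(1)] by linarith
  have "(v - c - \<delta>) / S \<le> (INF a\<in>U. F a)"
  proof (rule cINF_greatest)
    fix a assume "a \<in> U"
    then obtain z where z: "z < K" "real S * \<bar>F a - F (p z)\<bar> \<le> \<delta>" using net by blast
    have "real S * (F (p z) - F a) \<le> real S * \<bar>F a - F (p z)\<bar>" by (intro mult_left_mono) auto
    then have "real S * F (p z) - \<delta> \<le> real S * F a" using z(2) by (simp add: right_diff_distrib)
    moreover have "real v \<le> f z" using low[OF z(1)] by simp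
    ultimately have "v - c - \<delta> \<le> real S * F a" using f[OF z(1)] by linarith
    then show "(v - c - \<delta>) / S \<le> F a" using S by (simp add: pos_divide_le_eq mult.commute)
  qed (use p in blast)
  then have "v - c - \<delta> \<le> real S * (INF a\<in>U. F a)"
    using S by (simp add: pos_divide_le_eq mult.commute)
  then show ?thesis using upper \<delta> unfolding v_def by linarith
qed

text \<open>The error of the evaluator, in units of \<open>1/S\<close>, where \<open>S\<close> is the scale of its values.\<close>

fun eval_error :: "cform \<Rightarrow> nat" where
  "eval_error (FDist t u) = 1"
| "eval_error FZero = 0"
| "eval_error FOne = 0"
| "eval_error (FHalf \<phi>) = Suc (eval_error \<phi>)"
| "eval_error (FMonus \<phi> \<psi>) = eval_error \<phi> + eval_error \<psi>"
| "eval_error (FMin \<phi> \<psi>) = eval_error \<phi> + eval_error \<psi>"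
| "eval_error (FMax \<phi> \<psi>) = eval_error \<phi> + eval_error \<psi>"
| "eval_error (FAbsDiff \<phi> \<psi>) = eval_error \<phi> + eval_error \<psi>"
| "eval_error (FNeg \<phi>) = eval_error \<phi>"
| "eval_error (FPlus \<phi> \<psi>) = eval_error \<phi> + eval_error \<psi>"
| "eval_error (FSup x \<phi>) = eval_error \<phi> + lipschitz \<phi>"
| "eval_error (FInf x \<phi>) = eval_error \<phi> + lipschitz \<phi>"

section \<open>Constants, Lipschitz constants and errors bounded by the code\<close>

lemma add_le_prod_encode: "a + b \<le> prod_encode (a, b)"
proof -
  have "n \<le> triangle n" for n by (induction n) auto
  then show ?thesis by (simp add: prod_encode_def trans_le_add1)
qed

text \<open>Codes exceed the sum of their parts, not merely each part: this absorbs the addition of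
  errors, and it puts every quantified variable below the code of the sentence.\<close>

lemma fcode_less:
  "fcode \<phi> < fcode (FHalf \<phi>)" "fcode \<phi> < fcode (FNeg \<phi>)"
  "fcode \<phi> + fcode \<psi> < fcode (FMonus \<phi> \<psi>)" "fcode \<phi> + fcode \<psi> < fcode (FMin \<phi> \<psi>)"
  "fcode \<phi> + fcode \<psi> < fcode (FMax \<phi> \<psi>)" "fcode \<phi> + fcode \<psi> < fcode (FAbsDiff \<phi> \<psi>)"
  "fcode \<phi> + fcode \<psi> < fcode (FPlus \<phi> \<psi>)"
  "x + fcode \<phi> < fcode (FSup x \<phi>)" "x + fcode \<phi> < fcode (FInf x \<phi>)"
  using add_le_prod_encode[of 3 "fcode \<phi>"] add_le_prod_encode[of 8 "fcode \<phi>"]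
    add_le_prod_encode[of "fcode \<phi>" "fcode \<psi>"] add_le_prod_encode[of x "fcode \<phi>"]
    add_le_prod_encode[of 4 "prod_encode (fcode \<phi>, fcode \<psi>)"]
    add_le_prod_encode[of 5 "prod_encode (fcode \<phi>, fcode \<psi>)"]
    add_le_prod_encode[of 6 "prod_encode (fcode \<phi>, fcode \<psi>)"]
    add_le_prod_encode[of 7 "prod_encode (fcode \<phi>, fcode \<psi>)"]
    add_le_prod_encode[of 9 "prod_encode (fcode \<phi>, fcode \<psi>)"]
    add_le_prod_encode[of 10 "prod_encode (x, fcode \<phi>)"]
    add_le_prod_encode[of 11 "prod_encode (x, fcode \<phi>)"]
  by simp_all

lemma lipschitz_le: "lipschitz \<phi> \<le> 2 * Suc (fcode \<phi>)"
proof (induction \<phi>)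
  case (FHalf \<phi>) then show ?case using fcode_less(1)[of \<phi>] by (simp del: fcode.simps)
next
  case (FNeg \<phi>) then show ?case using fcode_less(2)[of \<phi>] by (simp del: fcode.simps)
next
  case (FMonus \<phi> \<psi>) then show ?case using fcode_less(3)[of \<phi> \<psi>] by (simp del: fcode.simps)
next
  case (FMin \<phi> \<psi>) then show ?case using fcode_less(4)[of \<phi> \<psi>] by (simp del: fcode.simps)
next
  case (FMax \<phi> \<psi>) then show ?case using fcode_less(5)[of \<phi> \<psi>] by (simp del: fcode.simps)
next
  case (FAbsDiff \<phi> \<psi>) then show ?case using fcode_less(6)[of \<phi> \<psi>] by (simp del: fcode.simps)
next
  case (FPlus \<phi> \<psi>) then show ?case using fcode_less(7)[of \<phi> \<psi>] by (simp del: fcode.simps)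
next
  case (FSup x \<phi>) then show ?case using fcode_less(8)[of x \<phi>] by (simp del: fcode.simps)
next
  case (FInf x \<phi>) then show ?case using fcode_less(9)[of x \<phi>] by (simp del: fcode.simps)
qed auto

text \<open>Each quantifier adds a Lipschitz constant, linear in the code, so the total is
  quadratic. The bound lets the scale be computed from the code alone.\<close>

lemma eval_error_le: "eval_error \<phi> \<le> 2 * (Suc (fcode \<phi>))\<^sup>2"
proof -
  have sq_add: "m + n \<le> 2 * (Suc k)\<^sup>2"
    if "m \<le> 2 * (Suc i)\<^sup>2" "n \<le> 2 * (Suc j)\<^sup>2" "i + j < k" for m n i j k
  proof -
    have "(Suc i)\<^sup>2 + (Suc j)\<^sup>2 \<le> (Suc i + Suc j)\<^sup>2" by (simp add: power2_eq_square algebra_simps)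
    also have "\<dots> \<le> (Suc k)\<^sup>2" using that(3) by (intro power_mono) auto
    finally show ?thesis using that(1,2) by simp
  qed
  \<comment> \<open>A linear increment fits between consecutive squares; this serves the unary
    connectives and the quantifiers.\<close>
  have sq_lin: "m + n \<le> 2 * (Suc k)\<^sup>2"
    if "m \<le> 2 * (Suc i)\<^sup>2" "n \<le> 2 * Suc i" "i < k" for m n i k
  proof -
    have "(Suc i)\<^sup>2 + Suc i \<le> (Suc (Suc i))\<^sup>2" by (simp add: power2_eq_square algebra_simps)
    also have "\<dots> \<le> (Suc k)\<^sup>2" using that(3) by (intro power_mono) auto
    finally show ?thesis using that(1,2) by simp
  qed
  show ?thesis
  proof (induction \<phi>)
    case (FHalf \<phi>) then show ?case using sq_lin[OF _ _ fcode_less(1), of _ \<phi> 1] by (simp del: fcode.simps)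
  next
    case (FNeg \<phi>) then show ?case using sq_lin[OF _ _ fcode_less(2), of _ \<phi> 0] by (simp del: fcode.simps)
  next
    case (FMonus \<phi> \<psi>) then show ?case using sq_add[OF _ _ fcode_less(3)] by (simp del: fcode.simps)
  next
    case (FMin \<phi> \<psi>) then show ?case using sq_add[OF _ _ fcode_less(4)] by (simp del: fcode.simps)
  next
    case (FMax \<phi> \<psi>) then show ?case using sq_add[OF _ _ fcode_less(5)] by (simp del: fcode.simps)
  next
    case (FAbsDiff \<phi> \<psi>) then show ?case using sq_add[OF _ _ fcode_less(6)] by (simp del: fcode.simps)
  next
    case (FPlus \<phi> \<psi>) then show ?case using sq_add[OF _ _ fcode_less(7)] by (simp del: fcode.simps)
  next
    case (FSup x \<phi>)
    then show ?case using sq_lin[OF _ lipschitz_le add_lessD1[of "fcode \<phi>" x]] fcode_less(8)[of x \<phi>]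
      by (simp del: fcode.simps add: add.commute)
  next
    case (FInf x \<phi>)
    then show ?case using sq_lin[OF _ lipschitz_le add_lessD1[of "fcode \<phi>" x]] fcode_less(9)[of x \<phi>]
      by (simp del: fcode.simps add: add.commute)
  qed auto
qed

lemma tconsts_le: "i \<in> tconsts t \<Longrightarrow> i \<le> tcode t"
  by (cases t) (auto simp: le_prod_encode_2)

lemma fconsts_le: "i \<in> fconsts \<phi> \<Longrightarrow> i \<le> fcode \<phi>"
proof (induction \<phi>)
  case (FDist t u)
  then have "i \<le> tcode t \<or> i \<le> tcode u" using tconsts_le by auto
  then show ?case
    using le_prod_encode_1[of "tcode t" "tcode u"] le_prod_encode_2[of "tcode u" "tcode t"]
      le_prod_encode_2[of "prod_encode (tcode t, tcode u)" 0] by auto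
next
  case (FHalf \<phi>) then show ?case using fcode_less(1)[of \<phi>] by (auto simp del: fcode.simps)
next
  case (FNeg \<phi>) then show ?case using fcode_less(2)[of \<phi>] by (auto simp del: fcode.simps)
next
  case (FMonus \<phi> \<psi>) then show ?case using fcode_less(3)[of \<phi> \<psi>] by (auto simp del: fcode.simps)
next
  case (FMin \<phi> \<psi>) then show ?case using fcode_less(4)[of \<phi> \<psi>] by (auto simp del: fcode.simps)
next
  case (FMax \<phi> \<psi>) then show ?case using fcode_less(5)[of \<phi> \<psi>] by (auto simp del: fcode.simps)
next
  case (FAbsDiff \<phi> \<psi>) then show ?case using fcode_less(6)[of \<phi> \<psi>] by (auto simp del: fcode.simps)
next
  case (FPlus \<phi> \<psi>) then show ?case using fcode_less(7)[of \<phi> \<psi>] by (auto simp del: fcode.simps)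
next
  case (FSup x \<phi>) then show ?case using fcode_less(8)[of x \<phi>] by (auto simp del: fcode.simps)
next
  case (FInf x \<phi>) then show ?case using fcode_less(9)[of x \<phi>] by (auto simp del: fcode.simps)
qed auto

context urysohn_presentation
begin

section \<open>Finite nets of one-point types in the presentation\<close>

definition rel :: "nat \<Rightarrow> nat \<Rightarrow> nat \<Rightarrow> nat \<Rightarrow> bool" where
  "rel i j a b \<longleftrightarrow> 0 < b \<and> a \<le> b \<and> d (s i) (s j) = real a / real b"

lemma decidable_rel_rel [rec_intros]:
  assumes "recursive n f1" "recursive n f2" "recursive n f3" "recursive n f4"
  shows "decidable_rel n (\<lambda>xs. rel (f1 xs) (f2 xs) (f3 xs) (f4 xs))"
proof -
  have "decidable_rel 4 (\<lambda>xs. rel (xs ! 0) (xs ! 1) (xs ! 2) (xs ! 3))"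
    using presentation by (simp add: decidable_presentation_def rel_def)
  from recursive_comp4[OF this[unfolded decidable_rel_def] assms]
  show ?thesis by (simp add: decidable_rel_def)
qed

text \<open>As distances are at most 1, the numerator is bounded by the denominator and only the
  latter needs an unbounded search.\<close>

lemma ex_rel: "\<exists>b. \<exists>a<Suc b. rel i j a b"
proof -
  have "0 \<le> d (s i) (s j)" by simp
  then obtain a b :: nat where ab: "b \<noteq> 0" "d (s i) (s j) = real a / real b"
    using Rats_abs_nat_div_natE[OF d_rational[of i j]] by (metis abs_of_nonneg)
  moreover have "a \<le> b" using ab d_le_1[of "s i" "s j"] by (simp add: divide_le_eq)
  ultimately show ?thesis by (auto simp: rel_def less_Suc_eq_le)
qed

lemma rel_mult: "rel i j a b \<Longrightarrow> 0 < k \<Longrightarrow> rel i j (a * k) (b * k)"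
  by (auto simp: rel_def)

text \<open>A common denominator of the distances among the first \<open>m\<close> points. Being at
  least \<open>S\<close>, it keeps rounding errors below one unit of the scale
  \<open>S\<close>.\<close>

definition den :: "nat \<Rightarrow> nat \<Rightarrow> nat" where
  "den m S = (LEAST N. S \<le> N \<and> 0 < N \<and> (\<forall>i<m. \<forall>j<m. \<exists>a<Suc N. rel i j a N))"

lemma ex_den: "\<exists>N. S \<le> N \<and> 0 < N \<and> (\<forall>i<m. \<forall>j<m. \<exists>a<Suc N. rel i j a N)"
proof -
  obtain q where q: "\<And>i j. \<exists>a. rel i j a (q i j)" using ex_rel by metis
  then have pos: "0 < q i j" for i j using rel_def by blast
  \<comment> \<open>A witness for termination only; the factor \<open>Suc S\<close> ensures
    \<open>S \<le> N\<close>.\<close>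
  define N where "N = Suc S * (\<Prod>i<m. \<Prod>j<m. q i j)"
  have prod: "0 < (\<Prod>i<m. \<Prod>j<m. q i j)" using pos by (simp add: prod_pos)
  have "S * 1 \<le> N" unfolding N_def using prod by (intro mult_le_mono) (simp_all only: Suc_leI One_nat_def le_SucI order_refl)
  then have "S \<le> N" by simp
  moreover have "0 < N" using prod by (simp add: N_def)
  moreover have "\<exists>a<Suc N. rel i j a N" if "i < m" "j < m" for i j
  proof -
    have "q i j dvd (\<Prod>j<m. q i j)" using that by (intro dvd_prodI) auto
    also have "\<dots> dvd (\<Prod>i<m. \<Prod>j<m. q i j)" using that by (intro dvd_prodI) auto
    also have "\<dots> dvd N" by (simp add: N_def)
    finally obtain k where k: "N = q i j * k" by blast
    obtain a where "rel i j a (q i j)" using q by blast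
    then have "rel i j (a * k) N" unfolding k using \<open>0 < N\<close> k by (intro rel_mult) auto
    then show ?thesis by (auto simp: rel_def less_Suc_eq_le)
  qed
  ultimately show ?thesis by blast
qed

lemma recursive_den [rec_intros]:
  assumes "recursive n f1" "recursive n f2"
  shows "recursive n (\<lambda>xs. den (f1 xs) (f2 xs))"
proof (rule recursive_comp2[OF _ assms])
  show "recursive 2 (\<lambda>xs. den (xs ! 0) (xs ! 1))"
    unfolding den_def by (intro rec_intros ex_den) auto
qed

lemma den_props: "S \<le> den m S" "0 < den m S" "i < m \<Longrightarrow> j < m \<Longrightarrow> \<exists>a. rel i j a (den m S)"
  using LeastI_ex[OF ex_den[of S m], folded den_def] by blast+

text \<open>Katetov functions, that is one-point extension types, over the first \<open>m\<close>
  points with values in multiples of 1/N, given by base \<open>Suc N\<close> digits. The bounded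
  \<open>a\<close> stands for the numerator of the distance, which keeps the condition
  decidable.\<close>

definition katetov :: "nat \<Rightarrow> nat \<Rightarrow> nat \<Rightarrow> bool" where
  "katetov m N g \<longleftrightarrow> (\<forall>i<m. \<forall>j<m. \<forall>a<Suc N. rel i j a N \<longrightarrow>
     dig (Suc N) g i \<le> dig (Suc N) g j + a \<and> a \<le> dig (Suc N) g i + dig (Suc N) g j)"

lemma decidable_katetov [rec_intros]:
  assumes "recursive n f1" "recursive n f2" "recursive n f3"
  shows "decidable_rel n (\<lambda>xs. katetov (f1 xs) (f2 xs) (f3 xs))"
proof -
  have "decidable_rel 3 (\<lambda>xs. katetov (xs ! 0) (xs ! 1) (xs ! 2))"
    unfolding katetov_def by (intro rec_intros) auto
  from recursive_comp3[OF this[unfolded decidable_rel_def] assms]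
  show ?thesis by (simp add: decidable_rel_def)
qed

text \<open>
  The points with numbers below \<open>net m S\<close> realise every one-point extension of the first \<open>m\<close>
  points whose distances are multiples of \<open>1/N\<close>, where \<open>N = den m S\<close>.
\<close>

definition net :: "nat \<Rightarrow> nat \<Rightarrow> nat" where
  "net m S = (LEAST K. m \<le> K \<and> (\<forall>g<Suc (den m S) ^ m. katetov m (den m S) g \<longrightarrow>
     (\<exists>y<K. \<forall>i<m. rel y i (dig (Suc (den m S)) g i) (den m S))))"

lemma katetov_realised:
  assumes g: "katetov m (den m S) g"
  shows "\<exists>y. \<forall>i<m. rel y i (dig (Suc (den m S)) g i) (den m S)"
proof -
  define N where "N = den m S"
  define h where "h i = real (dig (Suc N) g i) / N" for i
  have N: "0 < N" using den_props(2) by (simp add: N_def)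
  have le: "dig (Suc N) g i \<le> N" for i using dig_less[of "Suc N" g i] by simp
  have kat: "h i \<le> h j + d (s i) (s j)" "d (s i) (s j) \<le> h i + h j" if ij: "i < m" "j < m" for i j
  proof -
    \<comment> \<open>The common denominator guarantees that the condition on \<open>a\<close> in
      \<open>katetov\<close> is not vacuous.\<close>
    obtain a where a: "rel i j a N" using den_props(3)[OF ij] by (auto simp: N_def)
    then have "a < Suc N" by (simp add: rel_def)
    then have "dig (Suc N) g i \<le> dig (Suc N) g j + a" "a \<le> dig (Suc N) g i + dig (Suc N) g j"
      using g ij a by (auto simp: katetov_def N_def)
    then have "real (dig (Suc N) g i) \<le> dig (Suc N) g j + real a"
        "real a \<le> real (dig (Suc N) g i) + dig (Suc N) g j"
      by linarith+
    then show "h i \<le> h j + d (s i) (s j)" "d (s i) (s j) \<le> h i + h j"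
      using a N by (auto simp: h_def rel_def divide_simps)
  qed
  have "\<exists>y. \<forall>i<m. d (s y) (s i) = h i"
    by (rule QU_extension) (use kat le N in \<open>auto simp: h_def divide_simps\<close>)
  then show ?thesis using N le by (auto simp: rel_def h_def N_def)
qed

lemma ex_net: "\<exists>K. m \<le> K \<and> (\<forall>g<Suc (den m S) ^ m. katetov m (den m S) g \<longrightarrow>
     (\<exists>y<K. \<forall>i<m. rel y i (dig (Suc (den m S)) g i) (den m S)))"
proof -
  obtain y where y: "\<And>g. katetov m (den m S) g \<Longrightarrow>
      \<forall>i<m. rel (y g) i (dig (Suc (den m S)) g i) (den m S)"
    using katetov_realised by metis
  obtain K where K: "\<forall>n\<in>y ` {..<Suc (den m S) ^ m}. n < K"
    using finite_nat_set_iff_bounded[of "y ` {..<Suc (den m S) ^ m}"] by blast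
  show ?thesis
  proof (rule exI[of _ "m + K"], intro conjI allI impI)
    fix g
    assume "g < Suc (den m S) ^ m" "katetov m (den m S) g"
    then show "\<exists>y<m + K. \<forall>i<m. rel y i (dig (Suc (den m S)) g i) (den m S)"
      using y K by (intro exI[of _ "y g"]) (auto simp: trans_less_add2)
  qed simp
qed

lemma recursive_net [rec_intros]:
  assumes "recursive n f1" "recursive n f2"
  shows "recursive n (\<lambda>xs. net (f1 xs) (f2 xs))"
proof (rule recursive_comp2[OF _ assms])
  show "recursive 2 (\<lambda>xs. net (xs ! 0) (xs ! 1))"
    unfolding net_def by (intro rec_intros ex_net) auto
qed

lemma net_ge: "m \<le> net m S"
  using LeastI_ex[OF ex_net[of m S], folded net_def] by blast

text \<open>Types, not points, are dense: the distances of \<open>x\<close>, rounded up to multiples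
  of 1/N, form a Katetov function, which some point below \<open>net m S\<close> realises.\<close>

lemma net_dense:
  assumes x: "x \<in> U"
  shows "\<exists>y<net m S. \<forall>i<m. \<bar>d x (s i) - d (s y) (s i)\<bar> \<le> 1 / den m S"
proof -
  define N where "N = den m S"
  have N: "0 < N" using den_props(2) by (simp add: N_def)
  define f where "f i = nat \<lceil>N * d x (s i)\<rceil>" for i
  have f: "real (f i) \<ge> N * d x (s i)" "real (f i) < N * d x (s i) + 1" for i
    by (simp_all add: f_def) linarith+
  have "N * d x (s i) \<le> N" for i
    using d_le_1[OF x s_U, of i] by (simp add: mult_left_le)
  then have f_le: "f i \<le> N" for i by (auto simp: f_def ceiling_le_iff)
  obtain g where g: "g < Suc N ^ m" "\<And>i. i < m \<Longrightarrow> dig (Suc N) g i = f i"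
    using ex_digits[of m f "Suc N"] f_le by (auto simp: less_Suc_eq_le)
  \<comment> \<open>Rounding up preserves both inequalities because the distances \<open>d (s i) (s j)\<close> are
    multiples of \<open>1/N\<close>.\<close>
  have "katetov m N g"
    unfolding katetov_def
  proof (intro allI impI)
    fix i j a
    assume ij: "i < m" "j < m" and "rel i j a N"
    then have a: "N * d (s i) (s j) = a" using N by (simp add: rel_def)
    have "d x (s i) \<le> d x (s j) + d (s i) (s j)" "d (s i) (s j) \<le> d x (s i) + d x (s j)"
      using triangle[OF x s_U s_U, of i j] triangle[OF s_U x s_U, of i j]
        triangle[OF x s_U s_U, of j i] commute[of "s i" "s j"] commute[of "s i" x]
      by linarith+
    then have "N * d x (s i) \<le> N * (d x (s j) + d (s i) (s j))"
        "N * d (s i) (s j) \<le> N * (d x (s i) + d x (s j))"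
      by (auto intro: mult_left_mono)
    then have *: "N * d x (s i) \<le> N * d x (s j) + a" "a \<le> N * d x (s i) + N * d x (s j)"
      using a by (simp_all add: distrib_left)
    \<comment> \<open>A ceiling is less than its argument plus 1; integrality turns this strict
      bound into the required one.\<close>
    have "real (f i) < real (f j + a + 1)" using *(1) f(1)[of j] f(2)[of i] by simp
    moreover have "real a \<le> real (f i + f j)" using *(2) f(1)[of i] f(1)[of j] by simp
    ultimately show "dig (Suc N) g i \<le> dig (Suc N) g j + a \<and> a \<le> dig (Suc N) g i + dig (Suc N) g j"
      using g(2) ij by (simp only: of_nat_less_iff of_nat_le_iff) simp
  qed
  then obtain y where y: "y < net m S" "\<And>i. i < m \<Longrightarrow> rel y i (dig (Suc N) g i) N"
    using LeastI_ex[OF ex_net[of m S], folded net_def] g(1) by (auto simp: N_def)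
  have "\<bar>d x (s i) - d (s y) (s i)\<bar> \<le> 1 / N" if "i < m" for i
  proof -
    have "d (s y) (s i) = f i / N" using y(2)[OF that] g(2)[OF that] by (simp add: rel_def)
    then show ?thesis using f[of i] N by (simp add: abs_le_iff field_simps)
  qed
  then show ?thesis using y(1) by (auto simp: N_def)
qed

text \<open>
  The quantifiers at nesting depth \<open>j\<close> range over the points with numbers below \<open>lev c S (Suc j)\<close>,
  a net over the points below \<open>lev c S j\<close>; the latter include all earlier points and, as
  \<open>lev c S 0 = Suc c\<close>, all constants of the sentence with code \<open>c\<close>.
\<close>

definition lev :: "nat \<Rightarrow> nat \<Rightarrow> nat \<Rightarrow> nat" where
  "lev c S j = rec_nat (Suc c) (\<lambda>_ r. net r S) j"

lemma recursive_lev [rec_intros]: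
  assumes "recursive n f1" "recursive n f2" "recursive n f3"
  shows "recursive n (\<lambda>xs. lev (f1 xs) (f2 xs) (f3 xs))"
proof (rule recursive_comp3[OF _ assms])
  show "recursive 3 (\<lambda>xs. lev (xs ! 0) (xs ! 1) (xs ! 2))"
    unfolding lev_def by (intro recursive_rec_nat rec_intros) auto
qed

lemma lev_Suc: "lev c S (Suc j) = net (lev c S j) S"
  by (simp add: lev_def)

lemma lev_mono: "i \<le> j \<Longrightarrow> lev c S i \<le> lev c S j"
  by (rule lift_Suc_mono_le) (auto simp: lev_Suc net_ge)

lemma less_lev: "c < lev c S j"
proof -
  have "lev c S 0 = Suc c" by (simp add: lev_def)
  then show ?thesis using lev_mono[of 0 j c S] by simp
qed

text \<open>Depths \<open>c - k\<close> are at most \<open>c\<close>, so every point number used by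
  a quantifier is a digit in this base.\<close>

definition base :: "nat \<Rightarrow> nat \<Rightarrow> nat" where
  "base c S = lev c S (Suc c)"

text \<open>The number of coded assignments to the variables \<open>0\<close> to \<open>c\<close>;
  quantified variables of the sentence have smaller index than its code.\<close>

definition wid :: "nat \<Rightarrow> nat \<Rightarrow> nat" where
  "wid c S = base c S ^ Suc c"

lemma recursive_base [rec_intros]:
  "recursive n f1 \<Longrightarrow> recursive n f2 \<Longrightarrow> recursive n (\<lambda>xs. base (f1 xs) (f2 xs))"
  unfolding base_def by (intro rec_intros)

lemma recursive_wid [rec_intros]:
  "recursive n f1 \<Longrightarrow> recursive n f2 \<Longrightarrow> recursive n (\<lambda>xs. wid (f1 xs) (f2 xs))"
  unfolding wid_def by (intro rec_intros)

lemma lev_le_base: "j \<le> Suc c \<Longrightarrow> lev c S j \<le> base c S"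
  unfolding base_def by (rule lev_mono)

lemma wid_pos: "0 < wid c S"
  using less_lev[of c S "Suc c"] by (simp add: wid_def base_def)

text \<open>The presentation only decides equations d = a/b, so the fraction is found by search:
  first the denominator, then the numerator.\<close>

definition dden :: "nat \<Rightarrow> nat \<Rightarrow> nat" where
  "dden i j = (LEAST b. \<exists>a<Suc b. rel i j a b)"

definition dnum :: "nat \<Rightarrow> nat \<Rightarrow> nat" where
  "dnum i j = (LEAST a. rel i j a (dden i j))"

lemma ex_dnum: "\<exists>a. rel i j a (dden i j)"
  using LeastI_ex[OF ex_rel[of i j], folded dden_def] by blast

lemma recursive_dden [rec_intros]:
  assumes "recursive n f1" "recursive n f2"
  shows "recursive n (\<lambda>xs. dden (f1 xs) (f2 xs))"
proof (rule recursive_comp2[OF _ assms])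
  show "recursive 2 (\<lambda>xs. dden (xs ! 0) (xs ! 1))"
    unfolding dden_def by (intro rec_intros ex_rel) auto
qed

lemma recursive_dnum [rec_intros]:
  assumes "recursive n f1" "recursive n f2"
  shows "recursive n (\<lambda>xs. dnum (f1 xs) (f2 xs))"
proof (rule recursive_comp2[OF _ assms])
  show "recursive 2 (\<lambda>xs. dnum (xs ! 0) (xs ! 1))"
    unfolding dnum_def by (intro rec_intros ex_dnum) auto
qed

definition dapp :: "nat \<Rightarrow> nat \<Rightarrow> nat \<Rightarrow> nat" where
  "dapp S i j = dnum i j * S div dden i j"

lemma recursive_dapp [rec_intros]:
  "recursive n f1 \<Longrightarrow> recursive n f2 \<Longrightarrow> recursive n f3 \<Longrightarrow>
    recursive n (\<lambda>xs. dapp (f1 xs) (f2 xs) (f3 xs))"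
  unfolding dapp_def by (intro rec_intros)

lemma dapp_approximates: "dapp S i j \<le> S" "\<bar>real S * d (s i) (s j) - dapp S i j\<bar> \<le> 1"
proof -
  define a b where "a = dnum i j" and "b = dden i j"
  have "rel i j a b" unfolding a_def b_def dnum_def by (rule LeastI_ex[OF ex_dnum])
  then have b: "0 < b" "a \<le> b" and eq: "d (s i) (s j) = real a / real b" by (auto simp: rel_def)
  have "dapp S i j \<le> b * S div b"
    unfolding dapp_def a_def[symmetric] b_def[symmetric] by (intro div_le_mono mult_le_mono1 b)
  then show "dapp S i j \<le> S" using b by simp
  have "real S * d (s i) (s j) = real (a * S) / real b" by (simp add: eq)
  moreover have "dapp S i j = nat \<lfloor>real (a * S) / real b\<rfloor>"
    by (simp add: dapp_def a_def b_def floor_divide_of_nat_eq del: of_nat_mult)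
  moreover have "0 \<le> real (a * S) / real b" by simp
  ultimately show "\<bar>real S * d (s i) (s j) - dapp S i j\<bar> \<le> 1" by linarith
qed

section \<open>The table of values\<close>

definition trm :: "nat \<Rightarrow> nat \<Rightarrow> nat \<Rightarrow> nat \<Rightarrow> nat" where
  "trm c S e u = (if pfst u = 0 then dig (base c S) e (psnd u) else psnd u)"

text \<open>The position \<open>a * wid c S + e\<close> orders the pairs of code and assignment by
  code first.\<close>

definition lkp :: "nat \<Rightarrow> nat \<Rightarrow> nat \<Rightarrow> nat \<Rightarrow> nat \<Rightarrow> nat" where
  "lkp c S h a e = dig (Suc S) h (a * wid c S + e)"

lemma recursive_trm [rec_intros]:
  "recursive n f1 \<Longrightarrow> recursive n f2 \<Longrightarrow> recursive n f3 \<Longrightarrow> recursive n f4 \<Longrightarrow>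
    recursive n (\<lambda>xs. trm (f1 xs) (f2 xs) (f3 xs) (f4 xs))"
  unfolding trm_def by (intro rec_intros)

lemma recursive_lkp [rec_intros]:
  "recursive n f1 \<Longrightarrow> recursive n f2 \<Longrightarrow> recursive n f3 \<Longrightarrow> recursive n f4 \<Longrightarrow>
    recursive n f5 \<Longrightarrow> recursive n (\<lambda>xs. lkp (f1 xs) (f2 xs) (f3 xs) (f4 xs) (f5 xs))"
  unfolding lkp_def by (intro rec_intros)

text \<open>
  One step of the evaluator: the subformula with code \<open>k\<close> of the sentence with code \<open>c\<close>, under the
  assignment coded by the base \<open>base c S\<close> digits of \<open>e\<close>, given the history \<open>h\<close> of earlier values.
  Codes decrease along subformulas, so \<open>c - k\<close> serves as a nesting depth for the quantifier bounds.
\<close>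

definition step :: "nat \<Rightarrow> nat \<Rightarrow> nat \<Rightarrow> nat \<Rightarrow> nat \<Rightarrow> nat" where
  "step c S h k e = min S
    (if pfst k = 0 then dapp S (trm c S e (pfst (psnd k))) (trm c S e (psnd (psnd k)))
     else if pfst k = 1 then 0
     else if pfst k = 2 then S
     else if pfst k = 3 then lkp c S h (psnd k) e div 2
     else if pfst k = 4 then lkp c S h (pfst (psnd k)) e - lkp c S h (psnd (psnd k)) e
     else if pfst k = 5 then min (lkp c S h (pfst (psnd k)) e) (lkp c S h (psnd (psnd k)) e)
     else if pfst k = 6 then max (lkp c S h (pfst (psnd k)) e) (lkp c S h (psnd (psnd k)) e)
     else if pfst k = 7 then (lkp c S h (pfst (psnd k)) e - lkp c S h (psnd (psnd k)) e) +
       (lkp c S h (psnd (psnd k)) e - lkp c S h (pfst (psnd k)) e)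
     else if pfst k = 8 then S - lkp c S h (psnd k) e
     else if pfst k = 9 then lkp c S h (pfst (psnd k)) e + lkp c S h (psnd (psnd k)) e
     else if pfst k = 10 then (LEAST v. \<forall>y<lev c S (Suc (c - k)).
       lkp c S h (psnd (psnd k)) (upd (base c S) e (pfst (psnd k)) y) \<le> v)
     else (LEAST v. \<exists>y<lev c S (Suc (c - k)).
       lkp c S h (psnd (psnd k)) (upd (base c S) e (pfst (psnd k)) y) \<le> v))"

lemma recursive_step [rec_intros]:
  assumes "recursive n f1" "recursive n f2" "recursive n f3" "recursive n f4" "recursive n f5"
  shows "recursive n (\<lambda>xs. step (f1 xs) (f2 xs) (f3 xs) (f4 xs) (f5 xs))"
proof (rule recursive_comp5[OF _ assms])
  \<comment> \<open>Both minimisations must succeed for all arguments, even those that code no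
    formula.\<close>
  have all: "\<exists>v. \<forall>y<K. f y \<le> v" for K and f :: "nat \<Rightarrow> nat"
    by (rule exI[of _ "Max (f ` {..<K})"]) auto
  have ex: "\<exists>v. \<exists>y<lev c S j. f y \<le> v" for c S j and f :: "nat \<Rightarrow> nat"
    using less_lev[of c S j] by (intro exI[of _ "f 0"] exI[of _ 0]) auto
  show "recursive 5 (\<lambda>xs. step (xs ! 0) (xs ! 1) (xs ! 2) (xs ! 3) (xs ! 4))"
    unfolding step_def by (intro rec_intros all ex) auto
qed

lemma step_le: "step c S h k e \<le> S"
  by (simp add: step_def)

text \<open>The table is its own accumulator: entry \<open>t\<close> becomes the base
  \<open>Suc S\<close> digit at position \<open>t\<close>, which is possible because
  \<open>step\<close> is capped at \<open>S\<close>.\<close>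

definition hist :: "nat \<Rightarrow> nat \<Rightarrow> nat \<Rightarrow> nat" where
  "hist c S t =
    rec_nat 0 (\<lambda>t h. h + step c S h (t div wid c S) (t mod wid c S) * Suc S ^ t) t"

lemma recursive_hist [rec_intros]:
  assumes "recursive n f1" "recursive n f2" "recursive n f3"
  shows "recursive n (\<lambda>xs. hist (f1 xs) (f2 xs) (f3 xs))"
proof (rule recursive_comp3[OF _ assms])
  show "recursive 3 (\<lambda>xs. hist (xs ! 0) (xs ! 1) (xs ! 2))"
    unfolding hist_def by (intro recursive_rec_nat rec_intros) auto
qed

definition ev :: "nat \<Rightarrow> nat \<Rightarrow> nat \<Rightarrow> nat \<Rightarrow> nat" where
  "ev c S k e = step c S (hist c S (k * wid c S + e)) k e"

lemma recursive_ev [rec_intros]: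
  "recursive n f1 \<Longrightarrow> recursive n f2 \<Longrightarrow> recursive n f3 \<Longrightarrow> recursive n f4 \<Longrightarrow>
    recursive n (\<lambda>xs. ev (f1 xs) (f2 xs) (f3 xs) (f4 xs))"
  unfolding ev_def by (intro rec_intros)

lemma ev_le: "ev c S k e \<le> S"
  unfolding ev_def by (rule step_le)

lemma hist_Suc:
  "hist c S (Suc t) =
    hist c S t + step c S (hist c S t) (t div wid c S) (t mod wid c S) * Suc S ^ t"
  by (simp add: hist_def)

lemma hist_less: "hist c S t < Suc S ^ t"
proof (induction t)
  case 0
  then show ?case by (simp add: hist_def)
next
  case (Suc t)
  then show ?case unfolding hist_Suc by (rule append_digit_less) (simp add: step_le less_Suc_eq_le)
qed

lemma dig_hist:
  "i < t \<Longrightarrow> dig (Suc S) (hist c S t) i = step c S (hist c S i) (i div wid c S) (i mod wid c S)"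
proof (induction t)
  case (Suc t)
  then show ?case
    unfolding hist_Suc
    by (subst dig_append_digit[OF hist_less]) (auto simp: step_le less_Suc_eq_le)
qed simp

text \<open>A smaller code occurs earlier in the table under every assignment, so a quantifier may
  look up its body under updated assignments.\<close>

lemma lkp_hist:
  assumes "a < k" "e' < wid c S"
  shows "lkp c S (hist c S (k * wid c S + e)) a e' = ev c S a e'"
proof -
  have "a * wid c S + e' < Suc a * wid c S" using assms(2) by simp
  also have "\<dots> \<le> k * wid c S" using assms(1) by (intro mult_le_mono1) simp
  finally have "a * wid c S + e' < k * wid c S + e" by simp
  then show ?thesis using assms(2) by (simp add: lkp_def dig_hist ev_def)
qed

section \<open>Correctness of the evaluator\<close>

lemma trm_tcode: "s (trm c S e (tcode t)) = tval s (\<lambda>x. s (dig (base c S) e x)) t"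
  by (cases t) (simp_all add: trm_def)

text \<open>The net matches types up to \<open>1 / den m S\<close>, and
  \<open>den m S \<ge> S\<close>; in units of 1/S the loss is therefore at most the Lipschitz
  constant.\<close>

lemma ev_quantifier_net:
  assumes cs: "fconsts \<phi> \<subseteq> {..c}"
    and e: "\<And>z. z \<in> fvars \<phi> - {x} \<Longrightarrow> \<epsilon> z < lev c S (c - k)" and a: "a \<in> U"
  shows "\<exists>y<lev c S (Suc (c - k)). real S *
    \<bar>fval U d s ((\<lambda>z. s (\<epsilon> z))(x := a)) \<phi> - fval U d s ((\<lambda>z. s (\<epsilon> z))(x := s y)) \<phi>\<bar> \<le> lipschitz \<phi>"
proof -
  define m where "m = lev c S (c - k)"
  obtain y where y: "y < net m S" "\<forall>i<m. \<bar>d a (s i) - d (s y) (s i)\<bar> \<le> 1 / den m S"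
    using net_dense[OF a] by blast
  have "fconsts \<phi> \<subseteq> {..<m}" using cs less_lev[of c S "c - k"] by (auto simp: m_def)
  then have "\<bar>fval U d s ((\<lambda>z. s (\<epsilon> z))(x := a)) \<phi> - fval U d s ((\<lambda>z. s (\<epsilon> z))(x := s y)) \<phi>\<bar>
      \<le> lipschitz \<phi> * (1 / den m S)"
    using a y(2) e by (intro fval_near_type) (auto simp: m_def)
  then have "real S * \<bar>fval U d s ((\<lambda>z. s (\<epsilon> z))(x := a)) \<phi> - fval U d s ((\<lambda>z. s (\<epsilon> z))(x := s y)) \<phi>\<bar>
      \<le> real S * (lipschitz \<phi> * (1 / den m S))"
    by (intro mult_left_mono) auto
  also have "\<dots> = lipschitz \<phi> * (real S / den m S)" by simp
  also have "\<dots> \<le> real (lipschitz \<phi>) * 1"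
    using den_props(1)[of S m] den_props(2)[of m S] by (intro mult_left_mono) auto
  finally show ?thesis using y(1) by (auto simp: lev_Suc m_def)
qed

text \<open>The induction invariant passes to the body: the chosen \<open>y\<close> lies one level
  up, and the strictly smaller code of the body makes its level at least that high.\<close>

lemma ev_quantifier_body:
  assumes less: "x + fcode \<phi> < k" and k: "k \<le> c" and e: "e < wid c S"
    and digits: "\<And>z. z \<in> fvars \<phi> - {x} \<Longrightarrow> dig (base c S) e z < lev c S (c - k)"
    and y: "y < lev c S (Suc (c - k))"
  shows "upd (base c S) e x y < wid c S"
    and "z \<in> fvars \<phi> \<Longrightarrow> dig (base c S) (upd (base c S) e x y) z < lev c S (c - fcode \<phi>)"
    and "(\<lambda>z. s (dig (base c S) (upd (base c S) e x y) z)) =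
      (\<lambda>z. s (dig (base c S) e z))(x := s y)"
proof -
  have yb: "y < base c S" using y lev_le_base[of "Suc (c - k)" c S] by simp
  show "upd (base c S) e x y < wid c S"
    unfolding wid_def by (rule upd_less) (use e yb less k in \<open>auto simp: wid_def\<close>)
  show "(\<lambda>z. s (dig (base c S) (upd (base c S) e x y) z)) =
      (\<lambda>z. s (dig (base c S) e z))(x := s y)"
    by (auto simp: dig_upd[OF yb])
  have "lev c S (Suc (c - k)) \<le> lev c S (c - fcode \<phi>)" "lev c S (c - k) \<le> lev c S (c - fcode \<phi>)"
    using less k by (auto intro!: lev_mono)
  then show "z \<in> fvars \<phi> \<Longrightarrow> dig (base c S) (upd (base c S) e x y) z < lev c S (c - fcode \<phi>)"
    using y digits[of z] by (auto simp: dig_upd[OF yb])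
qed

lemma ev_code_half:
  assumes "pfst k = 3" "psnd k = a" "a < k" "e < wid c S"
  shows "ev c S k e = ev c S a e div 2"
  using ev_le[of c S a e] lkp_hist[OF assms(3,4), of e]
  by (simp add: ev_def[of c S k] step_def assms(1,2))

lemma ev_code_neg:
  assumes "pfst k = 8" "psnd k = a" "a < k" "e < wid c S"
  shows "ev c S k e = S - ev c S a e"
  using ev_le[of c S a e] lkp_hist[OF assms(3,4), of e]
  by (simp add: ev_def[of c S k] step_def assms(1,2))

text \<open>The cap \<open>min S\<close> in \<open>step\<close> changes nothing except for the sum,
  where it is the truncation at 1.\<close>

lemma ev_code_binary:
  assumes "pfst (psnd k) = a" "psnd (psnd k) = b" "a + b < k" "e < wid c S"
  shows "pfst k = 4 \<Longrightarrow> ev c S k e = ev c S a e - ev c S b e"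
    and "pfst k = 5 \<Longrightarrow> ev c S k e = min (ev c S a e) (ev c S b e)"
    and "pfst k = 6 \<Longrightarrow> ev c S k e = max (ev c S a e) (ev c S b e)"
    and "pfst k = 7 \<Longrightarrow> ev c S k e = (ev c S a e - ev c S b e) + (ev c S b e - ev c S a e)"
    and "pfst k = 9 \<Longrightarrow> ev c S k e = min S (ev c S a e + ev c S b e)"
proof -
  have "a < k" "b < k" using assms(3) by auto
  note lkp = lkp_hist[OF this(1) assms(4), of e] lkp_hist[OF this(2) assms(4), of e]
  note le = ev_le[of c S a e] ev_le[of c S b e]
  show "ev c S k e = ev c S a e - ev c S b e" if "pfst k = 4"
    using le lkp by (simp add: ev_def[of c S k] step_def assms(1,2) that)
  show "ev c S k e = min (ev c S a e) (ev c S b e)" if "pfst k = 5"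
    using le lkp by (simp add: ev_def[of c S k] step_def assms(1,2) that)
  show "ev c S k e = max (ev c S a e) (ev c S b e)" if "pfst k = 6"
    using le lkp by (simp add: ev_def[of c S k] step_def assms(1,2) that)
  show "ev c S k e = (ev c S a e - ev c S b e) + (ev c S b e - ev c S a e)" if "pfst k = 7"
    using le lkp by (simp add: ev_def[of c S k] step_def assms(1,2) that)
  show "ev c S k e = min S (ev c S a e + ev c S b e)" if "pfst k = 9"
    using lkp by (simp add: ev_def[of c S k] step_def assms(1,2) that)
qed

lemma ev_code_quantifier:
  assumes "pfst (psnd k) = x" "psnd (psnd k) = a" "a < k"
    and upd: "\<And>y. y < lev c S (Suc (c - k)) \<Longrightarrow> upd (base c S) e x y < wid c S"
  shows "pfst k = 10 \<Longrightarrow> ev c S k e =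
      (LEAST v. \<forall>y<lev c S (Suc (c - k)). ev c S a (upd (base c S) e x y) \<le> v)"
    and "pfst k = 11 \<Longrightarrow> ev c S k e =
      (LEAST v. \<exists>y<lev c S (Suc (c - k)). ev c S a (upd (base c S) e x y) \<le> v)"
proof -
  let ?h = "hist c S (k * wid c S + e)"
  have lkp: "lkp c S ?h a (upd (base c S) e x y) = ev c S a (upd (base c S) e x y)"
    if "y < lev c S (Suc (c - k))" for y
    using that by (intro lkp_hist assms(3) upd)
  have all: "(\<lambda>v. \<forall>y<lev c S (Suc (c - k)). lkp c S ?h a (upd (base c S) e x y) \<le> v) =
      (\<lambda>v. \<forall>y<lev c S (Suc (c - k)). ev c S a (upd (base c S) e x y) \<le> v)"
    using lkp by auto
  have ex: "(\<lambda>v. \<exists>y<lev c S (Suc (c - k)). lkp c S ?h a (upd (base c S) e x y) \<le> v) =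
      (\<lambda>v. \<exists>y<lev c S (Suc (c - k)). ev c S a (upd (base c S) e x y) \<le> v)"
    by (simp add: fun_eq_iff lkp cong: conj_cong)
  have "(LEAST v. \<forall>y<lev c S (Suc (c - k)). ev c S a (upd (base c S) e x y) \<le> v) \<le> S"
    by (rule Least_le) (simp add: ev_le)
  then show "ev c S k e =
      (LEAST v. \<forall>y<lev c S (Suc (c - k)). ev c S a (upd (base c S) e x y) \<le> v)" if "pfst k = 10"
    unfolding ev_def[of c S k] step_def assms(1,2) that all by simp
  have "(LEAST v. \<exists>y<lev c S (Suc (c - k)). ev c S a (upd (base c S) e x y) \<le> v) \<le> S"
    by (rule Least_le) (use less_lev[of c S "Suc (c - k)"] in \<open>auto intro!: exI[of _ 0] simp: ev_le\<close>)
  then show "ev c S k e =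
      (LEAST v. \<exists>y<lev c S (Suc (c - k)). ev c S a (upd (base c S) e x y) \<le> v)" if "pfst k = 11"
    unfolding ev_def[of c S k] step_def assms(1,2) that ex by simp
qed

lemma less_lev_subformula: "v < lev c S (c - k) \<Longrightarrow> a < k \<Longrightarrow> v < lev c S (c - a)"
  by (meson lev_mono diff_le_mono2 less_imp_le less_le_trans)

text \<open>Free variables must name points below the current level, since the next net resolves
  types over those points only. The assignment \<open>e\<close> stays arbitrary because quantifiers
  update it.\<close>

lemma ev_approximates:
  assumes S: "0 < S" and "fcode \<phi> \<le> c" "e < wid c S"
    and "\<And>x. x \<in> fvars \<phi> \<Longrightarrow> dig (base c S) e x < lev c S (c - fcode \<phi>)"
  shows "\<bar>real S * fval U d s (\<lambda>x. s (dig (base c S) e x)) \<phi> - ev c S (fcode \<phi>) e\<bar>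
    \<le> eval_error \<phi>"
  using assms(2-)
proof (induction \<phi> arbitrary: e)
  case (FDist t u)
  show ?case
    using dapp_approximates(1)[of S "trm c S e (tcode t)" "trm c S e (tcode u)"]
      dapp_approximates(2)[of S "trm c S e (tcode t)" "trm c S e (tcode u)"]
    by (simp add: ev_def step_def trm_tcode min_absorb2)
next
  case FZero
  then show ?case by (simp add: ev_def step_def)
next
  case FOne
  then show ?case by (simp add: ev_def step_def)
next
  case (FHalf \<phi>)
  note less = fcode_less(1)[of \<phi>]
  have IH: "\<bar>real S * fval U d s (\<lambda>x. s (dig (base c S) e x)) \<phi> - ev c S (fcode \<phi>) e\<bar>
      \<le> eval_error \<phi>"
    using FHalf.prems less less_lev_subformula[OF _ less]
    by (intro FHalf.IH) (auto simp del: fcode.simps)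
  have "ev c S (fcode (FHalf \<phi>)) e = ev c S (fcode \<phi>) e div 2"
    by (rule ev_code_half[OF _ _ less FHalf.prems(2)]) simp_all
  \<comment> \<open>Integer halving loses at most 1/2, which a whole unit covers.\<close>
  moreover have "\<bar>r / 2 - real (v div 2)\<bar> \<le> b + 1" if "\<bar>r - real v\<bar> \<le> b" for r b and v :: nat
    using that by linarith
  ultimately show ?case using IH by (simp del: fcode.simps)
next
  case (FNeg \<phi>)
  note less = fcode_less(2)[of \<phi>]
  have IH: "\<bar>real S * fval U d s (\<lambda>x. s (dig (base c S) e x)) \<phi> - ev c S (fcode \<phi>) e\<bar>
      \<le> eval_error \<phi>"
    using FNeg.prems less less_lev_subformula[OF _ less]
    by (intro FNeg.IH) (auto simp del: fcode.simps)
  have "ev c S (fcode (FNeg \<phi>)) e = S - ev c S (fcode \<phi>) e"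
    by (rule ev_code_neg[OF _ _ less FNeg.prems(2)]) simp_all
  then have "real (ev c S (fcode (FNeg \<phi>)) e) = real S - ev c S (fcode \<phi>) e"
    using ev_le[of c S "fcode \<phi>" e] by (simp add: of_nat_diff)
  then show ?case
    using IH by (simp del: fcode.simps add: right_diff_distrib abs_minus_commute)
next
  case (FMonus \<phi> \<psi>)
  let ?f = "fval U d s (\<lambda>x. s (dig (base c S) e x))"
  note less = fcode_less(3)[of \<phi> \<psi>]
  then have less': "fcode \<phi> < fcode (FMonus \<phi> \<psi>)" "fcode \<psi> < fcode (FMonus \<phi> \<psi>)"
    by (simp_all del: fcode.simps)
  have IH: "\<bar>real S * ?f \<phi> - ev c S (fcode \<phi>) e\<bar> \<le> eval_error \<phi>"
      "\<bar>real S * ?f \<psi> - ev c S (fcode \<psi>) e\<bar> \<le> eval_error \<psi>"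
    using FMonus.prems less' less_lev_subformula[OF _ less'(1)] less_lev_subformula[OF _ less'(2)]
    by (intro FMonus.IH; auto simp del: fcode.simps)+
  have "real (ev c S (fcode (FMonus \<phi> \<psi>)) e) =
      max (real (ev c S (fcode \<phi>) e) - real (ev c S (fcode \<psi>) e)) 0"
    by (subst ev_code_binary(1)[OF _ _ less FMonus.prems(2)])
      (auto simp: of_nat_diff max_def min_def abs_if)
  moreover have "real S * ?f (FMonus \<phi> \<psi>) =
      max (real S * ?f \<phi> - real S * ?f \<psi>) 0"
    by (simp add: max_mult_distrib_left right_diff_distrib)
  ultimately show ?case
    using abs_monus_diff_le order_trans[OF _ add_mono[OF IH]]
    by (simp only: eval_error.simps of_nat_add)
next
  case (FMin \<phi> \<psi>)
  let ?f = "fval U d s (\<lambda>x. s (dig (base c S) e x))"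
  note less = fcode_less(4)[of \<phi> \<psi>]
  then have less': "fcode \<phi> < fcode (FMin \<phi> \<psi>)" "fcode \<psi> < fcode (FMin \<phi> \<psi>)"
    by (simp_all del: fcode.simps)
  have IH: "\<bar>real S * ?f \<phi> - ev c S (fcode \<phi>) e\<bar> \<le> eval_error \<phi>"
      "\<bar>real S * ?f \<psi> - ev c S (fcode \<psi>) e\<bar> \<le> eval_error \<psi>"
    using FMin.prems less' less_lev_subformula[OF _ less'(1)] less_lev_subformula[OF _ less'(2)]
    by (intro FMin.IH; auto simp del: fcode.simps)+
  have "real (ev c S (fcode (FMin \<phi> \<psi>)) e) =
      min (real (ev c S (fcode \<phi>) e)) (real (ev c S (fcode \<psi>) e))"
    by (subst ev_code_binary(2)[OF _ _ less FMin.prems(2)])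
      (auto simp: of_nat_diff max_def min_def abs_if)
  moreover have "real S * ?f (FMin \<phi> \<psi>) =
      min (real S * ?f \<phi>) (real S * ?f \<psi>)"
    by (simp add: min_mult_distrib_left)
  ultimately show ?case
    using abs_min_diff_le order_trans[OF _ add_mono[OF IH]]
    by (simp only: eval_error.simps of_nat_add)
next
  case (FMax \<phi> \<psi>)
  let ?f = "fval U d s (\<lambda>x. s (dig (base c S) e x))"
  note less = fcode_less(5)[of \<phi> \<psi>]
  then have less': "fcode \<phi> < fcode (FMax \<phi> \<psi>)" "fcode \<psi> < fcode (FMax \<phi> \<psi>)"
    by (simp_all del: fcode.simps)
  have IH: "\<bar>real S * ?f \<phi> - ev c S (fcode \<phi>) e\<bar> \<le> eval_error \<phi>"
      "\<bar>real S * ?f \<psi> - ev c S (fcode \<psi>) e\<bar> \<le> eval_error \<psi>"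
    using FMax.prems less' less_lev_subformula[OF _ less'(1)] less_lev_subformula[OF _ less'(2)]
    by (intro FMax.IH; auto simp del: fcode.simps)+
  have "real (ev c S (fcode (FMax \<phi> \<psi>)) e) =
      max (real (ev c S (fcode \<phi>) e)) (real (ev c S (fcode \<psi>) e))"
    by (subst ev_code_binary(3)[OF _ _ less FMax.prems(2)])
      (auto simp: of_nat_diff max_def min_def abs_if)
  moreover have "real S * ?f (FMax \<phi> \<psi>) =
      max (real S * ?f \<phi>) (real S * ?f \<psi>)"
    by (simp add: max_mult_distrib_left)
  ultimately show ?case
    using abs_max_diff_le order_trans[OF _ add_mono[OF IH]]
    by (simp only: eval_error.simps of_nat_add)
next
  case (FAbsDiff \<phi> \<psi>)
  let ?f = "fval U d s (\<lambda>x. s (dig (base c S) e x))"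
  note less = fcode_less(6)[of \<phi> \<psi>]
  then have less': "fcode \<phi> < fcode (FAbsDiff \<phi> \<psi>)" "fcode \<psi> < fcode (FAbsDiff \<phi> \<psi>)"
    by (simp_all del: fcode.simps)
  have IH: "\<bar>real S * ?f \<phi> - ev c S (fcode \<phi>) e\<bar> \<le> eval_error \<phi>"
      "\<bar>real S * ?f \<psi> - ev c S (fcode \<psi>) e\<bar> \<le> eval_error \<psi>"
    using FAbsDiff.prems less' less_lev_subformula[OF _ less'(1)] less_lev_subformula[OF _ less'(2)]
    by (intro FAbsDiff.IH; auto simp del: fcode.simps)+
  have "real (ev c S (fcode (FAbsDiff \<phi> \<psi>)) e) =
      \<bar>real (ev c S (fcode \<phi>) e) - real (ev c S (fcode \<psi>) e)\<bar>"
    by (subst ev_code_binary(4)[OF _ _ less FAbsDiff.prems(2)])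
      (auto simp: of_nat_diff max_def min_def abs_if)
  moreover have "real S * ?f (FAbsDiff \<phi> \<psi>) =
      \<bar>real S * ?f \<phi> - real S * ?f \<psi>\<bar>"
    by (simp add: abs_mult flip: right_diff_distrib)
  ultimately show ?case
    using abs_absdiff_diff_le order_trans[OF _ add_mono[OF IH]]
    by (simp only: eval_error.simps of_nat_add)
next
  case (FPlus \<phi> \<psi>)
  let ?f = "fval U d s (\<lambda>x. s (dig (base c S) e x))"
  note less = fcode_less(7)[of \<phi> \<psi>]
  then have less': "fcode \<phi> < fcode (FPlus \<phi> \<psi>)" "fcode \<psi> < fcode (FPlus \<phi> \<psi>)"
    by (simp_all del: fcode.simps)
  have IH: "\<bar>real S * ?f \<phi> - ev c S (fcode \<phi>) e\<bar> \<le> eval_error \<phi>"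
      "\<bar>real S * ?f \<psi> - ev c S (fcode \<psi>) e\<bar> \<le> eval_error \<psi>"
    using FPlus.prems less' less_lev_subformula[OF _ less'(1)] less_lev_subformula[OF _ less'(2)]
    by (intro FPlus.IH; auto simp del: fcode.simps)+
  have "real (ev c S (fcode (FPlus \<phi> \<psi>)) e) =
      min (real (ev c S (fcode \<phi>) e) + real (ev c S (fcode \<psi>) e)) (real S)"
    by (subst ev_code_binary(5)[OF _ _ less FPlus.prems(2)])
      (auto simp: of_nat_diff max_def min_def abs_if)
  moreover have "real S * ?f (FPlus \<phi> \<psi>) =
      min (real S * ?f \<phi> + real S * ?f \<psi>) (real S)"
    by (simp add: min_mult_distrib_left distrib_left)
  ultimately show ?case
    using abs_plus_diff_le order_trans[OF _ add_mono[OF IH]]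
    by (simp only: eval_error.simps of_nat_add)
next
  case (FSup x \<phi>)
  note less = fcode_less(8)[of x \<phi>]
  then have less': "fcode \<phi> < fcode (FSup x \<phi>)" by (simp del: fcode.simps)
  have digits: "dig (base c S) e z < lev c S (c - fcode (FSup x \<phi>))" if "z \<in> fvars \<phi> - {x}" for z
    using FSup.prems(3) that by (simp del: fcode.simps)
  let ?K = "lev c S (Suc (c - fcode (FSup x \<phi>)))"
  let ?\<epsilon> = "\<lambda>z. s (dig (base c S) e z)"
  have body: "upd (base c S) e x y < wid c S"
      "z \<in> fvars \<phi> \<Longrightarrow> dig (base c S) (upd (base c S) e x y) z < lev c S (c - fcode \<phi>)"
      "(\<lambda>z. s (dig (base c S) (upd (base c S) e x y) z)) = ?\<epsilon>(x := s y)"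
    if "y < ?K" for y z
    using ev_quantifier_body[OF less FSup.prems(1,2) _ that] digits by blast+
  have IH: "\<bar>real S * fval U d s (?\<epsilon>(x := s y)) \<phi> - ev c S (fcode \<phi>) (upd (base c S) e x y)\<bar>
      \<le> eval_error \<phi>" if "y < ?K" for y
    using FSup.IH[OF _ body(1)[OF that] body(2)[OF that]] FSup.prems(1) less'
    unfolding body(3)[OF that] by (simp del: fcode.simps)
  have eq: "ev c S (fcode (FSup x \<phi>)) e =
      (LEAST v. \<forall>y<?K. ev c S (fcode \<phi>) (upd (base c S) e x y) \<le> v)"
    by (rule ev_code_quantifier(1)[OF _ _ less' body(1)]) simp_all
  have cs: "fconsts \<phi> \<subseteq> {..c}"
    using fconsts_le[of _ \<phi>] less' FSup.prems(1) by (fastforce simp del: fcode.simps)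
  show ?case
    unfolding eq fval.simps eval_error.simps of_nat_add
  proof (rule Least_all_less_approximates_SUP[where p = s])
    show "bdd_above ((\<lambda>a. fval U d s (?\<epsilon>(x := a)) \<phi>) ` U)"
      by (rule fval_bdd) simp
    show "0 < ?K" using less_lev[of c S] by (meson le0 le_less_trans)
    show "\<exists>y<?K. real S * \<bar>fval U d s (?\<epsilon>(x := a)) \<phi> - fval U d s (?\<epsilon>(x := s y)) \<phi>\<bar>
        \<le> lipschitz \<phi>" if "a \<in> U" for a
      by (rule ev_quantifier_net[OF cs digits that])
  qed (use IH S in simp_all)
next
  case (FInf x \<phi>)
  note less = fcode_less(9)[of x \<phi>]
  then have less': "fcode \<phi> < fcode (FInf x \<phi>)" by (simp del: fcode.simps)
  have digits: "dig (base c S) e z < lev c S (c - fcode (FInf x \<phi>))" if "z \<in> fvars \<phi> - {x}" for z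
    using FInf.prems(3) that by (simp del: fcode.simps)
  let ?K = "lev c S (Suc (c - fcode (FInf x \<phi>)))"
  let ?\<epsilon> = "\<lambda>z. s (dig (base c S) e z)"
  have body: "upd (base c S) e x y < wid c S"
      "z \<in> fvars \<phi> \<Longrightarrow> dig (base c S) (upd (base c S) e x y) z < lev c S (c - fcode \<phi>)"
      "(\<lambda>z. s (dig (base c S) (upd (base c S) e x y) z)) = ?\<epsilon>(x := s y)"
    if "y < ?K" for y z
    using ev_quantifier_body[OF less FInf.prems(1,2) _ that] digits by blast+
  have IH: "\<bar>real S * fval U d s (?\<epsilon>(x := s y)) \<phi> - ev c S (fcode \<phi>) (upd (base c S) e x y)\<bar>
      \<le> eval_error \<phi>" if "y < ?K" for y
    using FInf.IH[OF _ body(1)[OF that] body(2)[OF that]] FInf.prems(1) less'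
    unfolding body(3)[OF that] by (simp del: fcode.simps)
  have eq: "ev c S (fcode (FInf x \<phi>)) e =
      (LEAST v. \<exists>y<?K. ev c S (fcode \<phi>) (upd (base c S) e x y) \<le> v)"
    by (rule ev_code_quantifier(2)[OF _ _ less' body(1)]) simp_all
  have cs: "fconsts \<phi> \<subseteq> {..c}"
    using fconsts_le[of _ \<phi>] less' FInf.prems(1) by (fastforce simp del: fcode.simps)
  show ?case
    unfolding eq fval.simps eval_error.simps of_nat_add
  proof (rule Least_ex_less_approximates_INF[where p = s])
    show "bdd_below ((\<lambda>a. fval U d s (?\<epsilon>(x := a)) \<phi>) ` U)"
      by (rule fval_bdd) simp
    show "0 < ?K" using less_lev[of c S] by (meson le0 le_less_trans)
    show "\<exists>y<?K. real S * \<bar>fval U d s (?\<epsilon>(x := a)) \<phi> - fval U d s (?\<epsilon>(x := s y)) \<phi>\<bar>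
        \<le> lipschitz \<phi>" if "a \<in> U" for a
      by (rule ev_quantifier_net[OF cs digits that])
  qed (use IH S in simp_all)
qed

text \<open>With T = 2 (c + 1)^2 bounding the error and S = 2 T n, dividing the evaluator's result
  by 2 T gives n times the value up to 1/2. Adding T before the integer division rounds to nearest,
  another 1/2; the total is the tolerance 1 of \<open>approximates\<close>.\<close>

definition value_approx :: "nat \<Rightarrow> nat \<Rightarrow> nat" where
  "value_approx c n =
    (ev c (4 * (Suc c)\<^sup>2 * n) c 0 + 2 * (Suc c)\<^sup>2) div (4 * (Suc c)\<^sup>2)"

lemma recursive_value_approx [rec_intros]:
  "recursive n f1 \<Longrightarrow> recursive n f2 \<Longrightarrow> recursive n (\<lambda>xs. value_approx (f1 xs) (f2 xs))"
  unfolding value_approx_def by (intro rec_intros)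

lemma value_approx_approximates:
  assumes "sentence \<phi>" "1 \<le> n"
  shows "approximates (value_approx (fcode \<phi>) n) n (sval U d s \<phi>)"
proof -
  define c T where "c = fcode \<phi>" and "T = 2 * (Suc c)\<^sup>2"
  define S where "S = 2 * T * n"
  define E where "E = ev c S c 0"
  define r where "r = sval U d s \<phi>"
  define k where "k = value_approx c n"
  have T: "0 < T" by (simp add: T_def)
  have S: "0 < S" using T assms(2) by (simp add: S_def)
  \<comment> \<open>A sentence has no free variables, so the digit condition is vacuous for the
    assignment coded by 0.\<close>
  have "\<bar>real S * fval U d s (\<lambda>x. s (dig (base c S) 0 x)) \<phi> - ev c S (fcode \<phi>) 0\<bar> \<le> eval_error \<phi>"
    by (rule ev_approximates[OF S]) (use assms(1) wid_pos in \<open>auto simp: c_def sentence_def\<close>)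
  then have "\<bar>real S * r - E\<bar> \<le> eval_error \<phi>"
    unfolding r_def sval_eq_fval[OF assms(1), of _ _ _ "\<lambda>x. s (dig (base c S) 0 x)"]
    by (simp add: E_def c_def)
  moreover have "real (eval_error \<phi>) \<le> T"
    using eval_error_le[of \<phi>] unfolding T_def c_def by (simp only: of_nat_le_iff)
  ultimately have r: "\<bar>real S * r - E\<bar> \<le> T" by linarith
  have k_eq: "k = (E + T) div (2 * T)"
    by (simp add: k_def value_approx_def E_def S_def T_def mult.assoc)
  have "k * (2 * T) \<le> E + T" unfolding k_eq by (rule div_times_less_eq_dividend)
  then have "real (k * (2 * T)) \<le> real (E + T)" by (simp only: of_nat_le_iff)
  then have lo: "2 * real T * real k \<le> real E + T" by (simp add: algebra_simps)
  have "E + T < Suc k * (2 * T)" unfolding k_eq using T by (simp add: dividend_less_div_times)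
  then have "real (E + T) < real (Suc k * (2 * T))" by (simp only: of_nat_less_iff)
  then have hi: "real E + T < 2 * real T * real k + 2 * real T" by (simp add: algebra_simps)
  have rS: "real S * r = 2 * real T * (n * r)" by (simp add: S_def)
  have "2 * real T * real k - 2 * real T \<le> 2 * real T * (n * r)"
      "2 * real T * (n * r) \<le> 2 * real T * real k + 2 * real T"
    using lo hi r rS by linarith+
  then have "2 * real T * (real k - 1) \<le> 2 * real T * (n * r)"
      "2 * real T * (n * r) \<le> 2 * real T * (real k + 1)"
    by (simp_all only: right_diff_distrib distrib_left mult_1_right of_nat_mult of_nat_numeral)
  then have "real k - 1 \<le> n * r" "n * r \<le> real k + 1"
    using T by (simp_all only: mult_le_cancel_left_pos[of "2 * real T"] of_nat_0_less_iff
        zero_less_mult_iff zero_less_numeral simp_thms)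
  then show ?thesis
    unfolding approximates_def c_def[symmetric] k_def[symmetric] r_def[symmetric]
    using assms(2) by (auto simp: divide_le_eq le_divide_eq mult.commute)
qed

end

theorem mainTheorem17:
  fixes U QU :: "'a set" and d :: "'a \<Rightarrow> 'a \<Rightarrow> real" and s :: "nat \<Rightarrow> 'a"
  assumes "urysohn_space U d"
    and "rational_urysohn_space QU d"
    and "QU \<subseteq> U"
    and "Metric_space.mtopology U d closure_of QU = U"
    and "decidable_presentation QU d s"
  shows "decidable_continuous_theory U d s \<and>
         (\<forall>\<phi>. sentence \<phi> \<longrightarrow> computable_real (sval U d s \<phi>))"
proof -
  interpret urysohn_presentation U QU d s
    using assms by unfold_locales
  have "recursive 2 (\<lambda>xs. value_approx (xs ! 0) (xs ! 1))"
    by (intro rec_intros) auto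
  then have "decidable_continuous_theory U d s"
    unfolding decidable_continuous_theory_def using value_approx_approximates
    by (intro exI[of _ "\<lambda>xs. value_approx (xs ! 0) (xs ! 1)"]) simp
  moreover have "computable_real (sval U d s \<phi>)" if "sentence \<phi>" for \<phi>
    unfolding computable_real_def
  \<comment> \<open>The uniform approximation with the code frozen to a constant.\<close>
  proof (intro conjI exI[of _ "\<lambda>xs. value_approx (fcode \<phi>) (xs ! 0)"])
    show "0 \<le> sval U d s \<phi>"
      unfolding sval_eq_fval[OF that, of _ _ _ s] using fval_in_unit[of s \<phi>] by simp
    show "recursive 1 (\<lambda>xs. value_approx (fcode \<phi>) (xs ! 0))"
      by (intro rec_intros) auto
  qed (use value_approx_approximates[OF that] in simp)
  ultimately show ?thesis by blast
qed

end
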